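(* Let $k$ be an algebraically closed field of characteristic $2$. With respect to the ordering $T_1,T_2,T_3$ of the simple $kA_4$-modules, the Cartan matrix $(C_{T_iT_j})$ of $kA_4$ is $$\begin{bmatrix}2&1&1\\1&2&1\\1&1&2\end{bmatrix}.$$
   Context: Let $\omega\in k$ be a primitive cube root of unity and $V_4=\langle(1,2)(3,4),(1,3)(2,4)\rangle\trianglelefteq A_4$. The simple left $kA_4$-modules are the one-dimensional modules $T_1,T_2,T_3$ on which $V_4$ acts trivially and $(1,2,3)$ acts as multiplication by $1$, $\omega$, $\omega^2$ respectively. The Cartan invariant $C_{ST}$ is the multiplicity of the simple module $S$ as a composition factor of the projective cover $P_T$ of the simple module $T$. *)

theory Defs
  imports
    "HOL-Algebra.Sym_Groups"
    "HOL-Algebra.AbelCoset"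
    "HOL-Algebra.Module"
    "HOL-Computational_Algebra.Polynomial"
    "Jordan_Normal_Form.Matrix"
begin

section \<open>Left modules over a ring\<close>

text \<open>The library locale \<^locale>\<open>module\<close> requires a commutative ring of scalars. Below, its
  axioms are restated for an arbitrary ring, acting on the left; the record type of modules and the
  locale \<^locale>\<open>submodule\<close> are those of the library. The fields for multiplication and
  unit that the record inherits play no role.\<close>

locale left_module = R?: ring R + M?: abelian_group M
  for R (structure) and M :: "('a, 'm) module" (structure) +
  assumes smult_closed:
      "\<lbrakk>a \<in> carrier R; x \<in> carrier M\<rbrakk> \<Longrightarrow> a \<odot>\<^bsub>M\<^esub> x \<in> carrier M"
    and smult_l_distr:
      "\<lbrakk>a \<in> carrier R; b \<in> carrier R; x \<in> carrier M\<rbrakk> \<Longrightarrow>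
        (a \<oplus> b) \<odot>\<^bsub>M\<^esub> x = a \<odot>\<^bsub>M\<^esub> x \<oplus>\<^bsub>M\<^esub> b \<odot>\<^bsub>M\<^esub> x"
    and smult_r_distr:
      "\<lbrakk>a \<in> carrier R; x \<in> carrier M; y \<in> carrier M\<rbrakk> \<Longrightarrow>
        a \<odot>\<^bsub>M\<^esub> (x \<oplus>\<^bsub>M\<^esub> y) = a \<odot>\<^bsub>M\<^esub> x \<oplus>\<^bsub>M\<^esub> a \<odot>\<^bsub>M\<^esub> y"
    and smult_assoc:
      "\<lbrakk>a \<in> carrier R; b \<in> carrier R; x \<in> carrier M\<rbrakk> \<Longrightarrow>
        (a \<otimes> b) \<odot>\<^bsub>M\<^esub> x = a \<odot>\<^bsub>M\<^esub> (b \<odot>\<^bsub>M\<^esub> x)"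
    and smult_one:
      "x \<in> carrier M \<Longrightarrow> \<one> \<odot>\<^bsub>M\<^esub> x = x"

definition lmod_hom :: "'a ring \<Rightarrow> ('a, 'm) module \<Rightarrow> ('a, 'n) module \<Rightarrow> ('m \<Rightarrow> 'n) set"
  where "lmod_hom R M N =
    {f. f \<in> carrier M \<rightarrow> carrier N
      \<and> (\<forall>x\<in>carrier M. \<forall>y\<in>carrier M. f (x \<oplus>\<^bsub>M\<^esub> y) = f x \<oplus>\<^bsub>N\<^esub> f y)
      \<and> (\<forall>a\<in>carrier R. \<forall>x\<in>carrier M. f (a \<odot>\<^bsub>M\<^esub> x) = a \<odot>\<^bsub>N\<^esub> f x)}"

definition lmod_isomorphic :: "'a ring \<Rightarrow> ('a, 'm) module \<Rightarrow> ('a, 'n) module \<Rightarrow> bool"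
  where "lmod_isomorphic R M N \<longleftrightarrow>
    (\<exists>f\<in>lmod_hom R M N. bij_betw f (carrier M) (carrier N))"

definition lmod_quotient :: "('a, 'm) module \<Rightarrow> 'm set \<Rightarrow> ('a, 'm set) module"
  where "lmod_quotient M H =
    \<lparr>carrier = a_rcosets\<^bsub>M\<^esub> H, mult = undefined, one = undefined, zero = H, add = set_add M,
     smult = (\<lambda>a X. \<Union>x\<in>X. H +>\<^bsub>M\<^esub> (a \<odot>\<^bsub>M\<^esub> x))\<rparr>"

definition simple_module :: "'a ring \<Rightarrow> ('a, 'm) module \<Rightarrow> bool"
  where "simple_module R M \<longleftrightarrow>
    left_module R M \<and> carrier M \<noteq> {\<zero>\<^bsub>M\<^esub>} \<and>
    (\<forall>H. submodule H R M \<longrightarrow> H = {\<zero>\<^bsub>M\<^esub>} \<or> H = carrier M)"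


section \<open>Composition factors\<close>

definition series_factor :: "('a, 'm) module \<Rightarrow> 'm set list \<Rightarrow> nat \<Rightarrow> ('a, 'm set) module"
  where "series_factor M Hs i = lmod_quotient (M\<lparr>carrier := Hs ! Suc i\<rparr>) (Hs ! i)"

definition composition_series :: "'a ring \<Rightarrow> ('a, 'm) module \<Rightarrow> 'm set list \<Rightarrow> bool"
  where "composition_series R M Hs \<longleftrightarrow>
    Hs \<noteq> [] \<and> hd Hs = {\<zero>\<^bsub>M\<^esub>} \<and> last Hs = carrier M \<and>
    (\<forall>H\<in>set Hs. submodule H R M) \<and>
    (\<forall>i. Suc i < length Hs \<longrightarrow>
      Hs ! i \<subseteq> Hs ! Suc i \<and> simple_module R (series_factor M Hs i))"

text \<open>By the Jordan--Hoelder theorem, the number described here does not depend on the composition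
  series. It is unspecified for modules without a composition series.\<close>

definition composition_multiplicity :: "'a ring \<Rightarrow> ('a, 's) module \<Rightarrow> ('a, 'm) module \<Rightarrow> nat"
  where "composition_multiplicity R S M =
    (THE n. \<exists>Hs. composition_series R M Hs \<and>
      n = card {i. Suc i < length Hs \<and> lmod_isomorphic R (series_factor M Hs i) S})"


section \<open>Projective covers and Cartan invariants\<close>

definition free_lmodule :: "'a ring \<Rightarrow> 'i set \<Rightarrow> ('a, 'i \<Rightarrow> 'a) module"
  where "free_lmodule R I =
    \<lparr>carrier = {u. (\<forall>i. u i \<in> carrier R) \<and> (\<forall>i. i \<notin> I \<longrightarrow> u i = \<zero>\<^bsub>R\<^esub>)
                  \<and> finite {i. u i \<noteq> \<zero>\<^bsub>R\<^esub>}},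
     mult = undefined, one = undefined,
     zero = (\<lambda>i. \<zero>\<^bsub>R\<^esub>), add = (\<lambda>u v i. u i \<oplus>\<^bsub>R\<^esub> v i),
     smult = (\<lambda>a u i. a \<otimes>\<^bsub>R\<^esub> u i)\<rparr>"

text \<open>A module is projective if it is (isomorphic to) a direct summand of a free module. Index sets
  from the carrier type of the module suffice: if \<open>P\<close> is a direct summand of some free module,
  then the canonical epimorphism onto \<open>P\<close> from the free module on the elements of \<open>P\<close> splits.\<close>

definition projective_module :: "'a ring \<Rightarrow> ('a, 'p) module \<Rightarrow> bool"
  where "projective_module R P \<longleftrightarrow> left_module R P \<and>
    (\<exists>I :: 'p set. \<exists>\<iota>\<in>lmod_hom R P (free_lmodule R I). \<exists>\<pi>\<in>lmod_hom R (free_lmodule R I) P.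
      \<forall>x\<in>carrier P. \<pi> (\<iota> x) = x)"

text \<open>The kernel of the epimorphism is required to be superfluous.\<close>

definition projective_cover ::
    "'a ring \<Rightarrow> ('a, 'p) module \<Rightarrow> ('p \<Rightarrow> 'm) \<Rightarrow> ('a, 'm) module \<Rightarrow> bool"
  where "projective_cover R P f M \<longleftrightarrow>
    projective_module R P \<and> left_module R M \<and>
    f \<in> lmod_hom R P M \<and> f ` carrier P = carrier M \<and>
    (\<forall>H. submodule H R P \<and> H <+>\<^bsub>P\<^esub> a_kernel P M f = carrier P \<longrightarrow> H = carrier P)"

text \<open>A projective cover \<open>P\<close> of a simple module \<open>T\<close> is unique up to isomorphism, and it is isomorphic
  to a direct summand of the regular module, because an epimorphism from \<open>R\<close> to \<open>T\<close> lifts to an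
  epimorphism from \<open>R\<close> to \<open>P\<close>. Hence it is no restriction that \<open>P\<close> has its elements in the type of
  the elements of \<open>R\<close>.\<close>

definition cartan_invariant :: "'a ring \<Rightarrow> ('a, 's) module \<Rightarrow> ('a, 't) module \<Rightarrow> nat"
  where "cartan_invariant R S T =
    (THE n. \<exists>(P :: ('a, 'a) module) f.
      projective_cover R P f T \<and> n = composition_multiplicity R S P)"

definition cartan_matrix :: "'a ring \<Rightarrow> ('a, 'm) module list \<Rightarrow> nat mat"
  where "cartan_matrix R Ts =
    mat (length Ts) (length Ts) (\<lambda>(i, j). cartan_invariant R (Ts ! i) (Ts ! j))"


section \<open>Group algebras\<close>

text \<open>An element of \<open>kG\<close> is the family of its coefficients, extended by \<open>0\<close> outside \<open>G\<close>.\<close>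

definition group_algebra_monom :: "'k::field \<Rightarrow> 'g \<Rightarrow> 'g \<Rightarrow> 'k"
  where "group_algebra_monom c g = (\<lambda>h. if h = g then c else 0)"

definition group_algebra :: "'g monoid \<Rightarrow> ('g \<Rightarrow> 'k::field) ring"
  where "group_algebra G =
    \<lparr>carrier = {a. (\<forall>g. g \<notin> carrier G \<longrightarrow> a g = 0) \<and> finite {g. a g \<noteq> 0}},
     mult = (\<lambda>a b g. if g \<in> carrier G
               then (\<Sum>h | h \<in> carrier G \<and> a h \<noteq> 0. a h * b (inv\<^bsub>G\<^esub> h \<otimes>\<^bsub>G\<^esub> g)) else 0),
     one = group_algebra_monom 1 \<one>\<^bsub>G\<^esub>,
     zero = (\<lambda>g. 0),
     add = (\<lambda>a b g. a g + b g)\<rparr>"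

text \<open>Scalars act on a \<open>kG\<close>-module through the multiples of the unit of \<open>kG\<close>.\<close>

definition one_dimensional :: "'g monoid \<Rightarrow> ('g \<Rightarrow> 'k::field, 'm) module \<Rightarrow> bool"
  where "one_dimensional G M \<longleftrightarrow>
    (\<exists>v\<in>carrier M. v \<noteq> \<zero>\<^bsub>M\<^esub> \<and>
      carrier M = range (\<lambda>c. group_algebra_monom c \<one>\<^bsub>G\<^esub> \<odot>\<^bsub>M\<^esub> v))"


section \<open>The alternating group of degree four\<close>

abbreviation A4 :: "(nat \<Rightarrow> nat) monoid"
  where "A4 \<equiv> alt_group 4"

definition V4 :: "(nat \<Rightarrow> nat) set"
  where "V4 = generate A4
    {cycle_of_list [1, 2] \<circ> cycle_of_list [3, 4], cycle_of_list [1, 3] \<circ> cycle_of_list [2, 4]}"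

definition primitive_root_of_unity :: "nat \<Rightarrow> 'k::field \<Rightarrow> bool"
  where "primitive_root_of_unity n z \<longleftrightarrow> z ^ n = 1 \<and> (\<forall>m. 0 < m \<and> m < n \<longrightarrow> z ^ m \<noteq> 1)"

text \<open>The one-dimensional \<open>kA\<^sub>4\<close>-modules on which \<open>V\<^sub>4\<close> acts trivially and \<open>(1,2,3)\<close> acts as
  multiplication by \<open>c\<close>.\<close>

definition A4_module :: "'k::field \<Rightarrow> ((nat \<Rightarrow> nat) \<Rightarrow> 'k, 'm) module \<Rightarrow> bool"
  where "A4_module c T \<longleftrightarrow>
    left_module (group_algebra A4) T \<and> one_dimensional A4 T \<and>
    (\<forall>g\<in>V4. \<forall>x\<in>carrier T. group_algebra_monom 1 g \<odot>\<^bsub>T\<^esub> x = x) \<and>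
    (\<forall>x\<in>carrier T. group_algebra_monom 1 (cycle_of_list [1, 2, 3]) \<odot>\<^bsub>T\<^esub> x
                    = group_algebra_monom c \<one>\<^bsub>A4\<^esub> \<odot>\<^bsub>T\<^esub> x)"

end

theory Submission
  imports Defs "HOL-Library.Product_Plus"
begin

text \<open>Write \<open>V\<^sub>4 = {1, a, b, ab}\<close> and \<open>g = (1,2,3)\<close>. Then \<open>A\<^sub>4\<close> is generated by \<open>a\<close>, \<open>b\<close> and \<open>g\<close>, where
  \<open>g\<close> has order prime to the characteristic and permutes \<open>a\<close>, \<open>ab\<close>, \<open>b\<close> cyclically by conjugation.

  Simple modules: in characteristic 2 the involutions \<open>a\<close> and \<open>b\<close> are unipotent, so a simple module has
  a nonzero \<open>V\<^sub>4\<close>-fixed vector. Since \<open>V\<^sub>4\<close> is normal, the images of this vector under \<open>g\<close> are fixed as well.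
  The projections \<open>1 + \<psi>\<^sup>2 g + \<psi> g\<^sup>2\<close> with \<open>\<psi>\<^sup>3 = 1\<close>, whose sum is 1, yield a nonzero fixed
  vector that is an eigenvector of \<open>g\<close> and so spans the module (\<open>simple_imp_A4_module\<close>). The eigenvalue determines
  the module up to isomorphism.

  Multiplicities: these projections are defined on every module, so passing to the \<open>\<psi>\<close>-eigenspace
  of \<open>g\<close> is exact. A one-dimensional factor contributes 1 or 0 to it according to whether \<open>g\<close> acts on
  that factor by \<open>\<psi>\<close>. Hence in any composition series the number of factors on which \<open>g\<close> acts by \<open>\<psi>\<close>
  is the dimension of the eigenspace (\<open>composition_count\<close>); in particular it does not depend on
  the series.

  Projective covers: let \<open>P\<close> cover the module with eigenvalue \<open>\<chi>\<close>. A generator of that module lifts to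
  an eigenvector \<open>p\<close> of \<open>g\<close> in \<open>P\<close> with eigenvalue \<open>\<chi>\<close>. The span of \<open>p, ap, bp, abp\<close> is a submodule
  that is mapped onto the simple module, so it is \<open>P\<close>, because the kernel is superfluous. These four vectors are also
  independent: the socle of \<open>kV\<^sub>4\<close> is spanned by \<open>N = 1 + a + b + ab\<close>, so a dependence would
  give \<open>N p = 0\<close>. But in a free module every element killed by \<open>N\<close> has the form
  \<open>(a + 1) x + (b + 1) y + (ab + 1) z\<close> (\<open>free_norm_zero\<close>), and this passes to the direct summand \<open>P\<close>. As \<open>V\<^sub>4\<close>
  acts trivially on the simple module, the image of \<open>p\<close> there would be 0
  (\<open>projective_cover_frame\<close>).

  So \<open>P\<close> has four coordinates, on which \<open>g\<close> acts by multiplication with \<open>\<chi>\<close> and a cyclic permutation of the last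
  three. The eigenspace for \<open>\<psi>\<close> then has dimension 2 if \<open>\<psi> = \<chi>\<close> and 1 otherwise (\<open>dim_eigen\<close>), which is the
  Cartan matrix. A cover exists: the left ideal generated by the idempotent \<open>1 + \<chi>\<^sup>2 g + \<chi> g\<^sup>2\<close>.\<close>

section \<open>The alternating group as an extension of the Klein four-group\<close>

definition a\<^sub>4 :: "nat \<Rightarrow> nat"
  where "a\<^sub>4 = cycle_of_list [1, 2] \<circ> cycle_of_list [3, 4]"

definition b\<^sub>4 :: "nat \<Rightarrow> nat"
  where "b\<^sub>4 = cycle_of_list [1, 3] \<circ> cycle_of_list [2, 4]"

definition g\<^sub>4 :: "nat \<Rightarrow> nat"
  where "g\<^sub>4 = cycle_of_list [1, 2, 3]"

lemma a4_apply: "a\<^sub>4 i = (if i = 1 then 2 else if i = 2 then 1 else if i = 3 then 4 else if i = 4 then 3 else i)"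
  by (simp add: a\<^sub>4_def Transposition.transpose_def)

lemma b4_apply: "b\<^sub>4 i = (if i = 1 then 3 else if i = 2 then 4 else if i = 3 then 1 else if i = 4 then 2 else i)"
  by (simp add: b\<^sub>4_def Transposition.transpose_def)

lemma g4_apply: "g\<^sub>4 i = (if i = 1 then 2 else if i = 2 then 3 else if i = 3 then 1 else i)"
  by (simp add: g\<^sub>4_def Transposition.transpose_def)

lemma A4_relations:
  "a\<^sub>4 \<circ> a\<^sub>4 = id" "b\<^sub>4 \<circ> b\<^sub>4 = id" "b\<^sub>4 \<circ> a\<^sub>4 = a\<^sub>4 \<circ> b\<^sub>4"
  "g\<^sub>4 \<circ> (g\<^sub>4 \<circ> g\<^sub>4) = id" "g\<^sub>4 \<circ> a\<^sub>4 = a\<^sub>4 \<circ> (b\<^sub>4 \<circ> g\<^sub>4)" "g\<^sub>4 \<circ> b\<^sub>4 = a\<^sub>4 \<circ> g\<^sub>4"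
  by (auto simp: fun_eq_iff a4_apply b4_apply g4_apply)

lemma id_in_A4: "id \<in> carrier A4"
  by (simp add: alt_group_carrier permutes_id)

lemma comp_in_A4: "x \<in> carrier A4 \<Longrightarrow> y \<in> carrier A4 \<Longrightarrow> x \<circ> y \<in> carrier A4"
  using alt_group_is_group[of 4] by (metis alt_group_mult group.is_monoid monoid.m_closed)

lemma permutes_1234:
  assumes "\<And>i. i \<notin> {1,2,3,4::nat} \<Longrightarrow> p i = i" "\<And>i. p (q i) = i" "\<And>i. q (p i) = i"
  shows "p permutes {1..4}"
proof -
  have "{1..4} = {1,2,3,4::nat}" by auto
  moreover have "bij p" using assms(2,3) by (intro o_bij[of q]) (auto simp: fun_eq_iff)
  ultimately show ?thesis using assms(1) by (simp add: permutes_def bij_iff)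
qed

lemma generators_in_A4: "a\<^sub>4 \<in> carrier A4" "b\<^sub>4 \<in> carrier A4" "g\<^sub>4 \<in> carrier A4"
proof -
  have "a\<^sub>4 permutes {1..4}"
    by (rule permutes_1234[of _ a\<^sub>4]) (auto simp: a4_apply)
  moreover have "evenperm a\<^sub>4"
    by (simp add: a\<^sub>4_def evenperm_comp evenperm_swap permutation_swap_id)
  ultimately show "a\<^sub>4 \<in> carrier A4" by (simp add: alt_group_carrier)
  have "b\<^sub>4 permutes {1..4}"
    by (rule permutes_1234[of _ b\<^sub>4]) (auto simp: b4_apply)
  moreover have "evenperm b\<^sub>4"
    by (simp add: b\<^sub>4_def evenperm_comp evenperm_swap permutation_swap_id)
  ultimately show "b\<^sub>4 \<in> carrier A4" by (simp add: alt_group_carrier)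
  have "g\<^sub>4 permutes {1..4}"
    by (rule permutes_1234[of _ "g\<^sub>4 \<circ> g\<^sub>4"]) (auto simp: g4_apply)
  moreover have "evenperm g\<^sub>4"
    by (simp add: g\<^sub>4_def evenperm_comp evenperm_swap permutation_swap_id)
  ultimately show "g\<^sub>4 \<in> carrier A4" by (simp add: alt_group_carrier)
qed

lemma A4_image: 
  assumes "x \<in> carrier A4" "i \<in> {1,2,3,4}" shows "x i \<in> {1,2,3,4}"
proof -
  have "{1..4} = {1,2,3,4::nat}" by auto
  then show ?thesis using assms permutes_in_image[of x "{1..4}" i] by (simp add: alt_group_carrier)
qed

lemma A4_inj: "x \<in> carrier A4 \<Longrightarrow> x i = x j \<Longrightarrow> i = j"
  by (meson alt_group_carrier permutes_inj injD)

lemma A4_eq_id: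
  assumes x: "x \<in> carrier A4" and "x 4 = 4" "x 1 = 1"
  shows "x = id"
proof -
  have "x 2 \<in> {2,3}" "x 3 \<in> {2,3}" "x 2 \<noteq> x 3"
    using A4_image[OF x, of 2] A4_image[OF x, of 3] A4_inj[OF x, of 2 4] A4_inj[OF x, of 2 1]
      A4_inj[OF x, of 3 4] A4_inj[OF x, of 3 1] A4_inj[OF x, of 2 3] assms(2,3) by auto
  moreover have out: "x i = i" if "i \<noteq> 2" "i \<noteq> 3" for i
  proof (cases "i \<in> {1..4}")
    case True
    then have "i = 1 \<or> i = 4" using that by auto
    then show ?thesis using assms(2,3) by auto
  next
    case False then show ?thesis using x by (simp add: alt_group_carrier permutes_def)
  qed
  moreover have "\<not> (x 2 = 3 \<and> x 3 = 2)"
  proof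
    assume "x 2 = 3 \<and> x 3 = 2"
    then have "x = Transposition.transpose 2 3"
      using out by (auto simp: fun_eq_iff Transposition.transpose_def)
    then show False using x by (simp add: alt_group_carrier evenperm_swap)
  qed
  ultimately have "x 2 = 2" "x 3 = 3" by auto
  then show ?thesis using out by (metis eq_id_iff)
qed

text \<open>The Klein four-group acts simply transitively on the four points, so an element of it moves the image
  of 4 back to 4. What remains is an even permutation of three points, hence a power of \<open>g\<^sub>4\<close>.\<close>

lemma A4_induct [consumes 1, case_names one a b g comp]:
  assumes x: "x \<in> carrier A4"
    and one: "Q id" and a: "Q a\<^sub>4" and b: "Q b\<^sub>4" and g: "Q g\<^sub>4"
    and comp: "\<And>x y. x \<in> carrier A4 \<Longrightarrow> y \<in> carrier A4 \<Longrightarrow> Q x \<Longrightarrow> Q y \<Longrightarrow> Q (x \<circ> y)"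
  shows "Q x"
proof -
  note G = generators_in_A4 id_in_A4 comp_in_A4
  have C: "Q y" if y: "y \<in> carrier A4" "y 4 = 4" for y
  proof -
    have "y 1 \<in> {1,2,3}" using A4_image[OF y(1), of 1] A4_inj[OF y(1), of 1 4] y(2) by auto
    then consider "y 1 = 1" | "y 1 = 2" | "y 1 = 3" by auto
    then show ?thesis
    proof cases
      case 1 then show ?thesis using A4_eq_id[OF y] one by auto
    next
      case 2
      then have "(g\<^sub>4 \<circ> g\<^sub>4) \<circ> y = id"
        using y by (intro A4_eq_id G) (auto simp: g4_apply)
      then have "y = g\<^sub>4"
        by (metis A4_relations(4) comp_assoc comp_id id_comp)
      then show ?thesis using g by simp
    next
      case 3
      then have "g\<^sub>4 \<circ> y = id"
        using y by (intro A4_eq_id G) (auto simp: g4_apply)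
      then have "y = g\<^sub>4 \<circ> g\<^sub>4"
        by (metis A4_relations(4) comp_assoc comp_id id_comp)
      then show ?thesis using g comp G by simp
    qed
  qed
  have *: "Q x" if "v \<in> carrier A4" "v \<circ> v = id" "Q v" "v (x 4) = 4" for v
  proof -
    have "Q (v \<circ> x)" using that x by (intro C comp_in_A4) auto
    then have "Q (v \<circ> (v \<circ> x))" using that x comp_in_A4 by (blast intro: comp)
    moreover have "v \<circ> (v \<circ> x) = x" using that(2) by (metis comp_assoc id_comp)
    ultimately show ?thesis by (simp only:)
  qed
  have "x 4 \<in> {1,2,3,4}" using A4_image[OF x, of 4] by auto
  then consider "x 4 = 4" | "x 4 = 3" | "x 4 = 2" | "x 4 = 1" by auto
  then show ?thesis
  proof cases
    case 1 then show ?thesis using C x by blast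
  next
    case 2 then show ?thesis using *[of "a\<^sub>4"] a G A4_relations by (simp add: a4_apply)
  next
    case 3 then show ?thesis using *[of "b\<^sub>4"] b G A4_relations by (simp add: b4_apply)
  next
    case 4
    have "a\<^sub>4 \<circ> b\<^sub>4 \<circ> (a\<^sub>4 \<circ> b\<^sub>4) = id" by (auto simp: fun_eq_iff a4_apply b4_apply)
    then show ?thesis using *[of "a\<^sub>4 \<circ> b\<^sub>4"] a b comp G 4 by (simp add: a4_apply b4_apply)
  qed
qed

lemma finite_A4: "finite (carrier A4)"
proof (rule ccontr)
  assume "infinite (carrier A4)"
  then show False using alt_group_card_carrier[of 4] by simp
qed

section \<open>The group algebra\<close>

abbreviation kA4 :: "((nat \<Rightarrow> nat) \<Rightarrow> 'k::field) ring"
  where "kA4 \<equiv> group_algebra A4"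

abbreviation mon :: "'k::field \<Rightarrow> (nat \<Rightarrow> nat) \<Rightarrow> (nat \<Rightarrow> nat) \<Rightarrow> 'k"
  where "mon \<equiv> group_algebra_monom"

lemma kA4_carrier: "r \<in> carrier kA4 \<longleftrightarrow> (\<forall>x. x \<notin> carrier A4 \<longrightarrow> r x = 0)"
  using finite_A4 by (auto simp: group_algebra_def intro: finite_subset)

lemma kA4_add: "r \<oplus>\<^bsub>kA4\<^esub> s = (\<lambda>x. r x + s x)" 
  and kA4_zero: "\<zero>\<^bsub>kA4\<^esub> = (\<lambda>x. 0)" and kA4_one: "\<one>\<^bsub>kA4\<^esub> = mon 1 id"
  by (simp_all add: group_algebra_def alt_group_one)

lemma mon_carrier: "s \<in> carrier A4 \<Longrightarrow> mon c s \<in> carrier kA4"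
  by (auto simp: kA4_carrier group_algebra_monom_def)

lemma mon_mult:
  assumes s: "s \<in> carrier A4"
  shows "mon c s \<otimes>\<^bsub>kA4\<^esub> r = (\<lambda>x. if x \<in> carrier A4 then c * r (inv' s \<circ> x) else 0)"
proof (cases "c = 0")
  case True then show ?thesis by (auto simp: group_algebra_def group_algebra_monom_def fun_eq_iff)
next
  case False
  then have "{h. h \<in> carrier A4 \<and> mon c s h \<noteq> 0} = {s}"
    using s by (auto simp: group_algebra_monom_def)
  then show ?thesis
    using s by (auto simp: group_algebra_def fun_eq_iff alt_group_inv_equality alt_group_mult group_algebra_monom_def)
qed

lemma mon_mult_mon:
  assumes s: "s \<in> carrier A4" and t: "t \<in> carrier A4"
  shows "mon c s \<otimes>\<^bsub>kA4\<^esub> mon d t = mon (c * d) (s \<circ> t)"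
proof -
  have bij: "bij s" using s alt_group_carrier permutes_bij by blast
  have "inv' s \<circ> x = t \<longleftrightarrow> x = s \<circ> t" for x
    using bij by (metis bij_is_inj bij_is_surj comp_assoc id_comp inv_o_cancel surj_iff)
  then show ?thesis
    using comp_in_A4[OF s t] unfolding mon_mult[OF s] by (auto simp: group_algebra_monom_def)
qed

lemma mon_add: "mon c s \<oplus>\<^bsub>kA4\<^esub> mon d s = mon (c + d) s"
  by (auto simp: kA4_add group_algebra_monom_def)

text \<open>Reduces every statement about the action of the whole group algebra (closure of a subset, linearity
  of a map) to scalars and the three generators of the group.\<close>

lemma kA4_induct [consumes 1, case_names scalar a b g add mult]:
  fixes r :: "(nat \<Rightarrow> nat) \<Rightarrow> 'k::field"
  assumes r: "r \<in> carrier kA4"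
    and scalar: "\<And>c. Q (mon c id)" and a: "Q (mon 1 a\<^sub>4)" and b: "Q (mon 1 b\<^sub>4)" and g: "Q (mon 1 g\<^sub>4)"
    and add: "\<And>r s. r \<in> carrier kA4 \<Longrightarrow> s \<in> carrier kA4 \<Longrightarrow> Q r \<Longrightarrow> Q s \<Longrightarrow> Q (r \<oplus>\<^bsub>kA4\<^esub> s)"
    and mult: "\<And>r s. r \<in> carrier kA4 \<Longrightarrow> s \<in> carrier kA4 \<Longrightarrow> Q r \<Longrightarrow> Q s \<Longrightarrow> Q (r \<otimes>\<^bsub>kA4\<^esub> s)"
  shows "Q r"
proof -
  have 1: "Q (mon 1 s)" if "s \<in> carrier A4" for s
    using that
  proof (induction rule: A4_induct)
    case (comp x y)
    then show ?case using mult[of "mon 1 x" "mon 1 y"] by (simp add: mon_mult_mon mon_carrier del: comp_apply)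
  qed (fact scalar a b g)+
  have 2: "Q (mon c s)" if s: "s \<in> carrier A4" for c s
    using mult[of "mon c id" "mon 1 s", OF _ _ scalar 1[OF s]] s by (simp add: mon_carrier mon_mult_mon id_in_A4)
  have "Q (\<lambda>x. if x \<in> S then r x else 0)" if "finite S" "S \<subseteq> carrier A4" for S
    using that
  proof (induction S rule: finite_induct)
    case empty
    then show ?case using scalar[of 0] by (simp add: group_algebra_monom_def)
  next
    case (insert s S)
    have "(\<lambda>x. if x \<in> S then r x else 0) \<in> carrier kA4" using insert by (auto simp: kA4_carrier)
    from add[OF this, of "mon (r s) s"] insert 2
    have "Q (\<lambda>x. (if x \<in> S then r x else 0) + mon (r s) s x)" by (simp add: kA4_add mon_carrier)
    moreover have "(\<lambda>x. (if x \<in> S then r x else 0) + mon (r s) s x) = (\<lambda>x. if x \<in> insert s S then r x else 0)"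
      using insert by (auto simp: group_algebra_monom_def)
    ultimately show ?case by simp
  qed
  from this[OF finite_A4 subset_refl] have "Q (\<lambda>x. if x \<in> carrier A4 then r x else 0)" .
  moreover have "(\<lambda>x. if x \<in> carrier A4 then r x else 0) = r"
    using r unfolding kA4_carrier by fastforce
  ultimately show ?thesis by simp
qed

section \<open>Modules over the group algebra in characteristic two\<close>

definition scal :: "((nat \<Rightarrow> nat) \<Rightarrow> 'k::field, 'm) module \<Rightarrow> 'k \<Rightarrow> 'm \<Rightarrow> 'm"
  where "scal M c x = mon c id \<odot>\<^bsub>M\<^esub> x"

definition act :: "((nat \<Rightarrow> nat) \<Rightarrow> 'k::field, 'm) module \<Rightarrow> (nat \<Rightarrow> nat) \<Rightarrow> 'm \<Rightarrow> 'm"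
  where "act M s x = mon 1 s \<odot>\<^bsub>M\<^esub> x"

text \<open>The element \<open>\<alpha> + \<beta> a + \<gamma> b + \<delta> ab\<close> of \<open>kV\<^sub>4\<close> applied to \<open>x\<close>. All calculations with the action of \<open>V\<^sub>4\<close> are
  carried out on the coefficients.\<close>

definition comb :: "((nat \<Rightarrow> nat) \<Rightarrow> 'k::field, 'm) module \<Rightarrow> 'm \<Rightarrow> 'k \<times> 'k \<times> 'k \<times> 'k \<Rightarrow> 'm"
  where "comb M x = (\<lambda>(\<alpha>, \<beta>, \<gamma>, \<delta>).
    scal M \<alpha> x \<oplus>\<^bsub>M\<^esub> scal M \<beta> (act M a\<^sub>4 x) \<oplus>\<^bsub>M\<^esub> scal M \<gamma> (act M b\<^sub>4 x) \<oplus>\<^bsub>M\<^esub> scal M \<delta> (act M (a\<^sub>4 \<circ> b\<^sub>4) x))"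

lemmas A4_gens = id_in_A4 generators_in_A4

text \<open>Characteristic 2 is expressed by \<open>1 + 1 = 0\<close>, the form in which it is used: every element of a module is its
  own additive inverse, so that \<open>x\<close> and \<open>y\<close> are congruent modulo a submodule if and only if it contains \<open>x + y\<close>.\<close>

locale kA4_module = left_module "kA4 :: ((nat \<Rightarrow> nat) \<Rightarrow> 'k) ring" M
  for M :: "((nat \<Rightarrow> nat) \<Rightarrow> 'k::field, 'm) module" (structure) +
  assumes two: "(1::'k) + 1 = 0"
begin

lemma char2: "(c::'k) + c = 0"
  using two by (metis distrib_left mult.right_neutral mult_zero_right)

lemma char2': "- (c::'k) = c"
  using char2[of c] by (simp add: eq_neg_iff_add_eq_0[symmetric])

lemma scal_closed [simp, intro]: "x \<in> carrier M \<Longrightarrow> scal M c x \<in> carrier M"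
  by (simp add: scal_def smult_closed mon_carrier A4_gens)

lemma act_closed [simp, intro]: "s \<in> carrier A4 \<Longrightarrow> x \<in> carrier M \<Longrightarrow> act M s x \<in> carrier M"
  by (simp add: act_def smult_closed mon_carrier)

lemma scal_add_left: "x \<in> carrier M \<Longrightarrow> scal M (c + d) x = scal M c x \<oplus>\<^bsub>M\<^esub> scal M d x"
  by (simp add: scal_def smult_l_distr[symmetric] mon_carrier A4_gens mon_add)

lemma scal_add: "x \<in> carrier M \<Longrightarrow> y \<in> carrier M \<Longrightarrow> scal M c (x \<oplus>\<^bsub>M\<^esub> y) = scal M c x \<oplus>\<^bsub>M\<^esub> scal M c y"
  by (simp add: scal_def smult_r_distr mon_carrier A4_gens)

lemma act_add: "s \<in> carrier A4 \<Longrightarrow> x \<in> carrier M \<Longrightarrow> y \<in> carrier M \<Longrightarrow> act M s (x \<oplus>\<^bsub>M\<^esub> y) = act M s x \<oplus>\<^bsub>M\<^esub> act M s y"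
  by (simp add: act_def smult_r_distr mon_carrier)

lemma scal_scal: "x \<in> carrier M \<Longrightarrow> scal M c (scal M d x) = scal M (c * d) x"
  by (simp add: scal_def smult_assoc[symmetric] mon_carrier A4_gens mon_mult_mon)

lemma scal_one [simp]: "x \<in> carrier M \<Longrightarrow> scal M 1 x = x"
  using smult_one by (simp add: scal_def kA4_one)

lemma act_id [simp]: "x \<in> carrier M \<Longrightarrow> act M id x = x"
  using smult_one by (simp add: act_def kA4_one)

lemma act_act: "s \<in> carrier A4 \<Longrightarrow> t \<in> carrier A4 \<Longrightarrow> x \<in> carrier M \<Longrightarrow> act M s (act M t x) = act M (s \<circ> t) x"
  by (simp add: act_def smult_assoc[symmetric] mon_carrier mon_mult_mon)

lemma act_scal: "s \<in> carrier A4 \<Longrightarrow> x \<in> carrier M \<Longrightarrow> act M s (scal M c x) = scal M c (act M s x)"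
  by (simp add: act_def scal_def smult_assoc[symmetric] mon_carrier A4_gens mon_mult_mon)

lemma self_add_eq_zero: "x \<in> carrier M \<Longrightarrow> x = x \<oplus>\<^bsub>M\<^esub> x \<Longrightarrow> x = \<zero>\<^bsub>M\<^esub>"
  by (metis M.add.r_cancel_one')

lemma scal_0 [simp]: "x \<in> carrier M \<Longrightarrow> scal M 0 x = \<zero>\<^bsub>M\<^esub>"
  using self_add_eq_zero[OF scal_closed, of x 0] scal_add_left[of x 0 0] by (metis add_0)

lemma scal_zero [simp]: "scal M c \<zero>\<^bsub>M\<^esub> = \<zero>\<^bsub>M\<^esub>"
  using scal_add[of "\<zero>\<^bsub>M\<^esub>" "\<zero>\<^bsub>M\<^esub>" c] by (intro self_add_eq_zero) (auto simp del: M.add.r_cancel_one')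

lemma act_zero [simp]: "s \<in> carrier A4 \<Longrightarrow> act M s \<zero>\<^bsub>M\<^esub> = \<zero>\<^bsub>M\<^esub>"
  using act_add[of s "\<zero>\<^bsub>M\<^esub>" "\<zero>\<^bsub>M\<^esub>"] by (intro self_add_eq_zero) (auto simp del: M.add.r_cancel_one')

lemma add_self [simp]: "x \<in> carrier M \<Longrightarrow> x \<oplus>\<^bsub>M\<^esub> x = \<zero>\<^bsub>M\<^esub>"
  using scal_add_left[of x 1 1] two by simp

lemma add_cancel2: "x \<in> carrier M \<Longrightarrow> y \<in> carrier M \<Longrightarrow> x \<oplus>\<^bsub>M\<^esub> (x \<oplus>\<^bsub>M\<^esub> y) = y"
  by (simp add: M.a_assoc[symmetric])

lemma minus_self [simp]: "x \<in> carrier M \<Longrightarrow> \<ominus>\<^bsub>M\<^esub> x = x"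
  by (simp add: M.minus_equality)

lemma add_eq_zero_iff: "x \<in> carrier M \<Longrightarrow> y \<in> carrier M \<Longrightarrow> x \<oplus>\<^bsub>M\<^esub> y = \<zero>\<^bsub>M\<^esub> \<longleftrightarrow> x = y"
  by (metis add_self M.minus_equality minus_self)

lemma scal_eq_zero_iff: "x \<in> carrier M \<Longrightarrow> scal M c x = \<zero>\<^bsub>M\<^esub> \<longleftrightarrow> c = 0 \<or> x = \<zero>\<^bsub>M\<^esub>"
  by (metis scal_0 scal_zero scal_scal scal_one left_inverse)

lemma scal_inject: "x \<in> carrier M \<Longrightarrow> x \<noteq> \<zero>\<^bsub>M\<^esub> \<Longrightarrow> scal M c x = scal M d x \<longleftrightarrow> c = d"
  by (metis add_eq_zero_iff scal_closed scal_add_left scal_eq_zero_iff char2' eq_neg_iff_add_eq_0)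

lemma submoduleI:
  assumes "H \<subseteq> carrier M" "\<zero>\<^bsub>M\<^esub> \<in> H"
    and add: "\<And>x y. x \<in> H \<Longrightarrow> y \<in> H \<Longrightarrow> x \<oplus>\<^bsub>M\<^esub> y \<in> H"
    and scal: "\<And>c x. x \<in> H \<Longrightarrow> scal M c x \<in> H"
    and act: "\<And>x. x \<in> H \<Longrightarrow> act M a\<^sub>4 x \<in> H" "\<And>x. x \<in> H \<Longrightarrow> act M b\<^sub>4 x \<in> H" "\<And>x. x \<in> H \<Longrightarrow> act M g\<^sub>4 x \<in> H"
  shows "submodule H kA4 M"
proof (intro submodule.intro subgroup.intro submodule_axioms.intro)
  show "H \<subseteq> carrier (add_monoid M)" using assms(1) by simp
  show "x \<otimes>\<^bsub>add_monoid M\<^esub> y \<in> H" if "x \<in> H" "y \<in> H" for x y using add that by simp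
  show "\<one>\<^bsub>add_monoid M\<^esub> \<in> H" using assms(2) by simp
  show "inv\<^bsub>add_monoid M\<^esub> x \<in> H" if "x \<in> H" for x 
    using minus_self[of x] that assms(1) by (auto simp: a_inv_def)
  show "r \<odot>\<^bsub>M\<^esub> x \<in> H" if "r \<in> carrier kA4" "x \<in> H" for r x
    using that
  proof (induction r arbitrary: x rule: kA4_induct)
    case (add r s)
    then show ?case using assms(1) by (simp add: smult_l_distr subsetD assms(3))
  next
    case (mult r s)
    then show ?case using assms(1) by (simp add: smult_assoc subsetD)
  qed (use scal act in \<open>simp_all add: scal_def act_def\<close>)
qed

lemma submoduleD:
  assumes "submodule H kA4 M"
  shows "H \<subseteq> carrier M" "\<zero>\<^bsub>M\<^esub> \<in> H" "x \<in> H \<Longrightarrow> y \<in> H \<Longrightarrow> x \<oplus>\<^bsub>M\<^esub> y \<in> H"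
    "x \<in> H \<Longrightarrow> scal M c x \<in> H" "x \<in> H \<Longrightarrow> s \<in> carrier A4 \<Longrightarrow> act M s x \<in> H"
proof -
  interpret submodule H kA4 M by fact
  show "H \<subseteq> carrier M" "\<zero>\<^bsub>M\<^esub> \<in> H" "x \<in> H \<Longrightarrow> y \<in> H \<Longrightarrow> x \<oplus>\<^bsub>M\<^esub> y \<in> H"
    using subset one_closed m_closed by auto
  show "x \<in> H \<Longrightarrow> scal M c x \<in> H" "x \<in> H \<Longrightarrow> s \<in> carrier A4 \<Longrightarrow> act M s x \<in> H"
    by (auto simp: scal_def act_def mon_carrier A4_gens)
qed

text \<open>The idempotent \<open>(1 + \<psi>\<^sup>-\<^sup>1 g + \<psi>\<^sup>-\<^sup>2 g\<^sup>2) / 3\<close> of the group algebra of \<open>\<langle>g\<rangle>\<close>, for \<open>\<psi>\<^sup>3 = 1\<close> and \<open>3 = 1\<close>.\<close>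

definition eigen_proj :: "'k \<Rightarrow> 'm \<Rightarrow> 'm"
  where "eigen_proj \<psi> x = x \<oplus>\<^bsub>M\<^esub> scal M (\<psi>\<^sup>2) (act M g\<^sub>4 x) \<oplus>\<^bsub>M\<^esub> scal M \<psi> (act M g\<^sub>4 (act M g\<^sub>4 x))"

lemma eigen_proj_closed [simp, intro]: "x \<in> carrier M \<Longrightarrow> eigen_proj \<psi> x \<in> carrier M"
  by (simp add: eigen_proj_def A4_gens)

lemma act_eigen_proj:
  assumes x: "x \<in> carrier M" and "\<psi> ^ 3 = 1"
  shows "act M g\<^sub>4 (eigen_proj \<psi> x) = scal M \<psi> (eigen_proj \<psi> x)"
proof -
  have "\<psi> * \<psi>\<^sup>2 = 1" "\<psi> * \<psi> = \<psi>\<^sup>2" using assms(2) by (simp_all add: power2_eq_square power3_eq_cube mult.assoc)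
  moreover have "act M g\<^sub>4 (act M g\<^sub>4 (act M g\<^sub>4 x)) = x"
    using x by (simp add: act_act A4_gens comp_in_A4 A4_relations del: id_apply)
  ultimately show ?thesis using x A4_gens
    by (simp add: eigen_proj_def act_add act_scal scal_add scal_scal M.a_ac)
qed

lemma comb_closed [simp, intro]: "x \<in> carrier M \<Longrightarrow> comb M x u \<in> carrier M"
  by (cases u) (auto simp: comb_def A4_gens comp_in_A4)

lemma comb_add: "x \<in> carrier M \<Longrightarrow> comb M x u \<oplus>\<^bsub>M\<^esub> comb M x v = comb M x (u + v)"
  by (cases u; cases v) (simp add: comb_def A4_gens comp_in_A4 scal_add_left M.a_ac)

lemma comb_scal: "x \<in> carrier M \<Longrightarrow> scal M c (comb M x (\<alpha>, \<beta>, \<gamma>, \<delta>)) = comb M x (c * \<alpha>, c * \<beta>, c * \<gamma>, c * \<delta>)"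
  by (simp add: comb_def A4_gens comp_in_A4 scal_add scal_scal M.a_ac)

lemma V4_table:
  "a\<^sub>4 \<circ> (a\<^sub>4 \<circ> b\<^sub>4) = b\<^sub>4" "b\<^sub>4 \<circ> (a\<^sub>4 \<circ> b\<^sub>4) = a\<^sub>4" "g\<^sub>4 \<circ> (a\<^sub>4 \<circ> b\<^sub>4) = b\<^sub>4 \<circ> g\<^sub>4"
  by (auto simp: fun_eq_iff a4_apply b4_apply g4_apply)

lemma comb_act:
  assumes x: "x \<in> carrier M" 
  shows "act M a\<^sub>4 (comb M x (\<alpha>, \<beta>, \<gamma>, \<delta>)) = comb M x (\<beta>, \<alpha>, \<delta>, \<gamma>)"
    "act M b\<^sub>4 (comb M x (\<alpha>, \<beta>, \<gamma>, \<delta>)) = comb M x (\<gamma>, \<delta>, \<alpha>, \<beta>)"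
    "act M g\<^sub>4 (comb M x (\<alpha>, \<beta>, \<gamma>, \<delta>)) = comb M (act M g\<^sub>4 x) (\<alpha>, \<gamma>, \<delta>, \<beta>)"
  using x by (simp_all add: comb_def act_add act_scal act_act A4_gens comp_in_A4 V4_table A4_relations M.a_ac comp_assoc
     del: id_apply comp_apply)

lemma comb_eigen:
  assumes x: "x \<in> carrier M" and "act M g\<^sub>4 x = scal M \<chi> x"
  shows "act M g\<^sub>4 (comb M x (\<alpha>, \<beta>, \<gamma>, \<delta>)) = comb M x (\<chi> * \<alpha>, \<chi> * \<gamma>, \<chi> * \<delta>, \<chi> * \<beta>)"
  using assms by (simp add: comb_act) (simp add: comb_def act_scal A4_gens comp_in_A4 scal_scal mult.commute)

lemma comb_fixed:
  assumes "x \<in> carrier M" "act M a\<^sub>4 x = x" "act M b\<^sub>4 x = x" 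
  shows "comb M x (\<alpha>, \<beta>, \<gamma>, \<delta>) = scal M (\<alpha> + \<beta> + \<gamma> + \<delta>) x"
proof -
  have "act M (a\<^sub>4 \<circ> b\<^sub>4) x = x" using act_act[of a\<^sub>4 b\<^sub>4 x] assms A4_gens by simp
  then show ?thesis using assms by (simp add: comb_def scal_add_left)
qed

lemma comb_zero [simp]: "x \<in> carrier M \<Longrightarrow> comb M x (0, 0, 0, 0) = \<zero>\<^bsub>M\<^esub>"
  by (simp add: comb_def A4_gens comp_in_A4)

lemma comb_1000 [simp]: "x \<in> carrier M \<Longrightarrow> comb M x (1, 0, 0, 0) = x"
  by (simp add: comb_def A4_gens comp_in_A4)

end

lemma (in kA4_module) eigen_proj_fixed:
  assumes "x \<in> carrier M" "act M g\<^sub>4 x = scal M \<psi> x" "\<psi> ^ 3 = 1"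
  shows "eigen_proj \<psi> x = x"
proof -
  have "\<psi>\<^sup>2 * \<psi> = 1" "\<psi> * (\<psi> * \<psi>) = 1"
    using assms(3) by (simp_all add: power2_eq_square power3_eq_cube mult.assoc)
  then show ?thesis using assms A4_gens by (simp add: eigen_proj_def act_scal scal_scal)
qed

lemma (in kA4_module) submodule_is_module:
  assumes "submodule H kA4 M" shows "kA4_module (M\<lparr>carrier := H\<rparr>)"
proof -
  note D = submoduleD[OF assms]
  have c: "x \<in> H \<Longrightarrow> x \<in> carrier M" for x using D(1) by auto
  have "abelian_group (M\<lparr>carrier := H\<rparr>)"
  proof (rule abelian_groupI)
    fix x assume "x \<in> carrier (M\<lparr>carrier := H\<rparr>)"
    then show "\<exists>y\<in>carrier (M\<lparr>carrier := H\<rparr>). y \<oplus>\<^bsub>M\<lparr>carrier := H\<rparr>\<^esub> x = \<zero>\<^bsub>M\<lparr>carrier := H\<rparr>\<^esub>"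
      using c by (intro bexI[of _ x]) auto
  qed (use D c in \<open>auto simp: M.a_ac\<close>)
  moreover have "left_module_axioms kA4 (M\<lparr>carrier := H\<rparr>)"
    by unfold_locales
      (use c submodule.smult_closed[OF assms] in \<open>auto simp: smult_l_distr smult_r_distr smult_assoc smult_one\<close>)
  ultimately have "left_module kA4 (M\<lparr>carrier := H\<rparr>)" by (intro left_module.intro R.ring_axioms)
  then show ?thesis using two by (simp add: kA4_module_def kA4_module_axioms_def)
qed

lemma (in kA4_module) submodule_comb:
  assumes "submodule H kA4 M" "x \<in> H" shows "comb M x u \<in> H"
  by (cases u) (simp add: comb_def submoduleD[OF assms(1)] assms(2) A4_gens comp_in_A4)

text \<open>The squares of the elements of \<open>V\<^sub>4\<close> are 1, and squaring is additive on the commutative ring \<open>kV\<^sub>4\<close> of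
  characteristic 2. So the square of an element of \<open>kV\<^sub>4\<close> is the square of its augmentation; in particular elements of
  augmentation 1 are invertible, which makes the kernel of the cover constructed below superfluous.\<close>

lemma (in kA4_module) comb_comb:
  assumes x: "x \<in> carrier M"
  shows "comb M (comb M x (\<alpha>, \<beta>, \<gamma>, \<delta>)) (\<alpha>, \<beta>, \<gamma>, \<delta>) = scal M ((\<alpha> + \<beta> + \<gamma> + \<delta>)\<^sup>2) x"
proof -
  let ?h = "comb M x (\<alpha>, \<beta>, \<gamma>, \<delta>)"
  have "act M (a\<^sub>4 \<circ> b\<^sub>4) ?h = comb M x (\<delta>, \<gamma>, \<beta>, \<alpha>)"
    using x A4_gens by (simp add: act_act[symmetric] comb_act)
  then have "comb M ?h (\<alpha>, \<beta>, \<gamma>, \<delta>) = comb M x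
     (\<alpha> * \<alpha> + \<beta> * \<beta> + \<gamma> * \<gamma> + \<delta> * \<delta>, (\<alpha> * \<beta> + \<gamma> * \<delta>) + (\<alpha> * \<beta> + \<gamma> * \<delta>),
      (\<alpha> * \<gamma> + \<beta> * \<delta>) + (\<alpha> * \<gamma> + \<beta> * \<delta>), (\<alpha> * \<delta> + \<beta> * \<gamma>) + (\<alpha> * \<delta> + \<beta> * \<gamma>))"
    unfolding comb_def[of M ?h] using x by (simp add: comb_act comb_scal comb_add) (simp add: ac_simps)
  also have "\<dots> = scal M (\<alpha> * \<alpha> + \<beta> * \<beta> + \<gamma> * \<gamma> + \<delta> * \<delta>) x"
    using x A4_gens comp_in_A4 by (simp add: char2 comb_def)
  also have "\<alpha> * \<alpha> + \<beta> * \<beta> + \<gamma> * \<gamma> + \<delta> * \<delta> = (\<alpha> + \<beta> + \<gamma> + \<delta>)\<^sup>2"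
  proof -
    have "(y + z)\<^sup>2 = y\<^sup>2 + z\<^sup>2" for y z :: 'k
    proof -
      have "(y + z)\<^sup>2 = y\<^sup>2 + z\<^sup>2 + (y * z + y * z)" by (simp add: power2_eq_square algebra_simps)
      then show ?thesis using char2 by simp
    qed
    then show ?thesis by (simp add: power2_eq_square)
  qed
  finally show ?thesis .
qed

lemma kA4_homI:
  assumes M: "kA4_module M" and N: "kA4_module N"
    and f: "f \<in> carrier M \<rightarrow> carrier N"
    and add: "\<And>x y. x \<in> carrier M \<Longrightarrow> y \<in> carrier M \<Longrightarrow> f (x \<oplus>\<^bsub>M\<^esub> y) = f x \<oplus>\<^bsub>N\<^esub> f y"
    and scal: "\<And>c x. x \<in> carrier M \<Longrightarrow> f (scal M c x) = scal N c (f x)"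
    and act: "\<And>x. x \<in> carrier M \<Longrightarrow> f (act M a\<^sub>4 x) = act N a\<^sub>4 (f x)"
      "\<And>x. x \<in> carrier M \<Longrightarrow> f (act M b\<^sub>4 x) = act N b\<^sub>4 (f x)"
      "\<And>x. x \<in> carrier M \<Longrightarrow> f (act M g\<^sub>4 x) = act N g\<^sub>4 (f x)"
  shows "f \<in> lmod_hom kA4 M N"
proof -
  interpret M: kA4_module M by fact
  interpret N: kA4_module N by fact
  have "f (r \<odot>\<^bsub>M\<^esub> x) = r \<odot>\<^bsub>N\<^esub> f x" if "r \<in> carrier kA4" "x \<in> carrier M" for r x
    using that
  proof (induction r arbitrary: x rule: kA4_induct)
    case (add r s)
    then show ?case using f
      by (simp add: M.smult_l_distr N.smult_l_distr assms(4) M.smult_closed Pi_mem[OF f])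
  next
    case (mult r s)
    then show ?case using f
      by (simp add: M.smult_assoc N.smult_assoc M.smult_closed Pi_mem[OF f])
  qed (use scal act in \<open>simp_all add: scal_def act_def\<close>)
  then show ?thesis using f add by (simp add: lmod_hom_def)
qed

lemma lmod_hom_scal: "f \<in> lmod_hom kA4 M N \<Longrightarrow> x \<in> carrier M \<Longrightarrow> f (scal M c x) = scal N c (f x)"
  and lmod_hom_act: "f \<in> lmod_hom kA4 M N \<Longrightarrow> x \<in> carrier M \<Longrightarrow> s \<in> carrier A4 \<Longrightarrow> f (act M s x) = act N s (f x)"
  by (simp_all add: lmod_hom_def scal_def act_def mon_carrier A4_gens)

lemma comb_hom:
  assumes "kA4_module M" and f: "f \<in> lmod_hom kA4 M N" and x: "x \<in> carrier M"
  shows "f (comb M x u) = comb N (f x) u"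
proof -
  interpret M: kA4_module M by fact
  have "f (y \<oplus>\<^bsub>M\<^esub> z) = f y \<oplus>\<^bsub>N\<^esub> f z" if "y \<in> carrier M" "z \<in> carrier M" for y z
    using f that by (simp add: lmod_hom_def)
  then show ?thesis using x
    by (cases u) (simp add: comb_def lmod_hom_scal[OF f] lmod_hom_act[OF f] A4_gens comp_in_A4)
qed

lemma eigen_proj_hom:
  assumes "kA4_module M" "kA4_module N" and f: "f \<in> lmod_hom kA4 M N" and x: "x \<in> carrier M"
  shows "f (kA4_module.eigen_proj M \<psi> x) = kA4_module.eigen_proj N \<psi> (f x)"
proof -
  interpret M: kA4_module M by fact
  interpret N: kA4_module N by fact
  have "f (y \<oplus>\<^bsub>M\<^esub> z) = f y \<oplus>\<^bsub>N\<^esub> f z" if "y \<in> carrier M" "z \<in> carrier M" for y z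
    using f that by (simp add: lmod_hom_def)
  then show ?thesis using x
    by (simp add: M.eigen_proj_def N.eigen_proj_def lmod_hom_scal[OF f] lmod_hom_act[OF f] A4_gens)
qed

section \<open>The simple modules\<close>

lemma A4_moduleI:
  assumes "kA4_module T" and t: "t \<in> carrier T" "t \<noteq> \<zero>\<^bsub>T\<^esub>"
    and span: "\<And>x. x \<in> carrier T \<Longrightarrow> \<exists>c. x = scal T c t"
    and act: "act T a\<^sub>4 t = t" "act T b\<^sub>4 t = t" "act T g\<^sub>4 t = scal T \<chi> t"
  shows "A4_module \<chi> T"
proof -
  interpret T: kA4_module T by fact
  have A4g: "group A4" by (rule alt_group_is_group)
  have "s \<in> carrier A4 \<and> act T s t = t" if "s \<in> V4" for s
    using that unfolding V4_def a\<^sub>4_def[symmetric] b\<^sub>4_def[symmetric]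
  proof (induction rule: generate.induct)
    case one
    then show ?case using T.act_id[OF t(1)] A4_gens by (simp add: alt_group_one del: id_apply)
  next
    case (incl h) then show ?case using act A4_gens by auto
  next
    case (inv h)
    have "inv\<^bsub>A4\<^esub> a\<^sub>4 = a\<^sub>4" "inv\<^bsub>A4\<^esub> b\<^sub>4 = b\<^sub>4"
      using group.inv_equality[OF A4g] A4_relations A4_gens by (simp_all add: alt_group_mult alt_group_one)
    then show ?case using inv act A4_gens by auto
  next
    case (eng h1 h2)
    then show ?case using T.act_act[of h1 h2 t] t comp_in_A4 unfolding alt_group_mult by metis
  qed
  then have V: "act T s x = x" if "s \<in> V4" "x \<in> carrier T" for s x
    using span[OF that(2)] that(1) t by (auto simp: T.act_scal)
  have g: "act T g\<^sub>4 x = scal T \<chi> x" if "x \<in> carrier T" for x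
    using span[OF that] t act A4_gens by (auto simp: T.act_scal T.scal_scal mult.commute)
  have "one_dimensional A4 T"
    unfolding one_dimensional_def alt_group_one scal_def[symmetric]
    by (rule bexI[OF _ t(1)]) (use t span in auto)
  then show ?thesis
    using V g T.left_module_axioms
    unfolding A4_module_def scal_def act_def alt_group_one g\<^sub>4_def[symmetric] by blast
qed

lemma A4_moduleD:
  assumes "A4_module \<chi> T"
  obtains t where "t \<in> carrier T" "t \<noteq> \<zero>\<^bsub>T\<^esub>"
    "\<And>x. x \<in> carrier T \<Longrightarrow> \<exists>c. x = scal T c t"
    "\<And>x. x \<in> carrier T \<Longrightarrow> act T a\<^sub>4 x = x" "\<And>x. x \<in> carrier T \<Longrightarrow> act T b\<^sub>4 x = x"
    "\<And>x. x \<in> carrier T \<Longrightarrow> act T g\<^sub>4 x = scal T \<chi> x"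
proof -
  have "a\<^sub>4 \<in> V4" "b\<^sub>4 \<in> V4" by (auto simp: V4_def a\<^sub>4_def b\<^sub>4_def intro: generate.incl)
  moreover obtain t where "t \<in> carrier T" "t \<noteq> \<zero>\<^bsub>T\<^esub>" "carrier T = range (\<lambda>c. scal T c t)"
    using assms by (auto simp: A4_module_def one_dimensional_def alt_group_one scal_def)
  ultimately show ?thesis using assms
    by (intro that[of t]) (auto simp: A4_module_def scal_def act_def alt_group_one g\<^sub>4_def)
qed

lemma A4_module_simple:
  fixes T :: "((nat \<Rightarrow> nat) \<Rightarrow> 'k::field, 'm) module"
  assumes "kA4_module T" "A4_module \<chi> T" shows "simple_module kA4 T"
proof -
  interpret T: kA4_module T by fact
  from assms(2) obtain t where t: "t \<in> carrier T" "t \<noteq> \<zero>\<^bsub>T\<^esub>"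
    and span: "\<And>x. x \<in> carrier T \<Longrightarrow> \<exists>c. x = scal T c t" by (rule A4_moduleD) blast
  have "H = carrier T" if H: "submodule H kA4 T" "H \<noteq> {\<zero>\<^bsub>T\<^esub>}" for H
  proof -
    note D = T.submoduleD[OF H(1)]
    obtain x where x: "x \<in> H" "x \<noteq> \<zero>\<^bsub>T\<^esub>" using D(2) H(2) by blast
    then obtain c where c: "x = scal T c t" using span D(1) by blast
    then have "scal T (d / c) x = scal T d t" for d
      using x t by (auto simp: T.scal_scal)
    then have "scal T d t \<in> H" for d using D(4)[OF x(1)] by metis
    then show ?thesis using span D(1) by blast
  qed
  then show ?thesis using t T.left_module_axioms by (auto simp: simple_module_def)
qed

lemma A4_module_isomorphic:
  fixes S :: "((nat \<Rightarrow> nat) \<Rightarrow> 'k::field, 'm) module" and T :: "((nat \<Rightarrow> nat) \<Rightarrow> 'k, 'n) module"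
  assumes "kA4_module S" "kA4_module T" "A4_module \<chi> S" "A4_module \<chi> T"
  shows "lmod_isomorphic kA4 S T"
proof -
  interpret S: kA4_module S by fact
  interpret T: kA4_module T by fact
  from assms(3) obtain s where s: "s \<in> carrier S" "s \<noteq> \<zero>\<^bsub>S\<^esub>"
    and spanS: "\<And>x. x \<in> carrier S \<Longrightarrow> \<exists>c. x = scal S c s"
    and S: "\<And>x. x \<in> carrier S \<Longrightarrow> act S a\<^sub>4 x = x" "\<And>x. x \<in> carrier S \<Longrightarrow> act S b\<^sub>4 x = x"
    "\<And>x. x \<in> carrier S \<Longrightarrow> act S g\<^sub>4 x = scal S \<chi> x" by (rule A4_moduleD) blast
  from assms(4) obtain t where t: "t \<in> carrier T" "t \<noteq> \<zero>\<^bsub>T\<^esub>"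
    and spanT: "\<And>x. x \<in> carrier T \<Longrightarrow> \<exists>c. x = scal T c t"
    and T: "\<And>x. x \<in> carrier T \<Longrightarrow> act T a\<^sub>4 x = x" "\<And>x. x \<in> carrier T \<Longrightarrow> act T b\<^sub>4 x = x"
    "\<And>x. x \<in> carrier T \<Longrightarrow> act T g\<^sub>4 x = scal T \<chi> x" by (rule A4_moduleD) blast
  define f where "f x = scal T (THE c. x = scal S c s) t" for x
  have f: "f (scal S c s) = scal T c t" for c
    using s by (simp add: f_def S.scal_inject)
  have fc: "f x \<in> carrier T" for x using t by (simp add: f_def)
  have scal: "f (scal S c x) = scal T c (f x)" if "x \<in> carrier S" for c x
    using spanS[OF that] s t by (auto simp: S.scal_scal T.scal_scal f)
  have "f \<in> lmod_hom kA4 S T"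
  proof (rule kA4_homI[OF assms(1,2)])
    fix x y assume "x \<in> carrier S" "y \<in> carrier S"
    then obtain c d where "x = scal S c s" "y = scal S d s" using spanS by blast
    then show "f (x \<oplus>\<^bsub>S\<^esub> y) = f x \<oplus>\<^bsub>T\<^esub> f y"
      using s t by (simp add: f S.scal_add_left[symmetric] T.scal_add_left[symmetric])
  qed (use scal fc S T in auto)
  moreover have "bij_betw f (carrier S) (carrier T)"
  proof (rule bij_betwI')
    fix x y assume "x \<in> carrier S" "y \<in> carrier S"
    then obtain c d where "x = scal S c s" "y = scal S d s" using spanS by blast
    then show "f x = f y \<longleftrightarrow> x = y" using s t by (simp add: f S.scal_inject T.scal_inject)
  next
    fix y assume "y \<in> carrier T"
    then show "\<exists>x\<in>carrier S. y = f x" using spanT s f by (metis S.scal_closed)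
  qed (rule fc)
  ultimately show ?thesis by (auto simp: lmod_isomorphic_def)
qed

lemma A4_module_isomorphic_imp_eq:
  fixes S :: "((nat \<Rightarrow> nat) \<Rightarrow> 'k::field, 'm) module" and T :: "((nat \<Rightarrow> nat) \<Rightarrow> 'k, 'n) module"
  assumes "kA4_module S" "kA4_module T" "A4_module \<chi> S" "A4_module \<psi> T" "lmod_isomorphic kA4 S T"
  shows "\<chi> = \<psi>"
proof -
  interpret S: kA4_module S by fact
  interpret T: kA4_module T by fact
  obtain f where f: "f \<in> lmod_hom kA4 S T" "bij_betw f (carrier S) (carrier T)"
    using assms(5) by (auto simp: lmod_isomorphic_def)
  from assms(4) obtain t where t: "t \<in> carrier T" "t \<noteq> \<zero>\<^bsub>T\<^esub>"
    and T: "\<And>x. x \<in> carrier T \<Longrightarrow> act T g\<^sub>4 x = scal T \<psi> x" by (rule A4_moduleD) blast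
  obtain s where s: "s \<in> carrier S" "f s = t" using f(2) t(1) by (metis bij_betw_iff_bijections)
  from assms(3) have "act S g\<^sub>4 s = scal S \<chi> s" using s(1) by (auto elim: A4_moduleD)
  then have "act T g\<^sub>4 t = scal T \<chi> t"
    using lmod_hom_scal[OF f(1) s(1)] lmod_hom_act[OF f(1) s(1) generators_in_A4(3)] s(2) by metis
  then show ?thesis using T t by (simp add: T.scal_inject)
qed

text \<open>If \<open>x\<close> is not fixed by \<open>a\<close>, then \<open>x + a x\<close> is, and it is nonzero; the same for \<open>b\<close> then gives a nonzero
  \<open>V\<^sub>4\<close>-fixed vector. Its three eigenprojections for \<open>g\<close> are fixed by \<open>V\<^sub>4\<close> and add up to it, so one of them is nonzero.
  The line that it spans is a submodule.\<close>

lemma simple_imp_A4_module: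
  fixes S :: "((nat \<Rightarrow> nat) \<Rightarrow> 'k::field, 'm) module" and \<omega> :: 'k
  assumes "kA4_module S" "simple_module kA4 S" and \<omega>: "\<omega> ^ 3 = 1" "\<omega> \<noteq> 1"
  shows "\<exists>\<psi>\<in>{1, \<omega>, \<omega>\<^sup>2}. A4_module \<psi> S"
proof -
  interpret S: kA4_module S by fact
  note G = A4_gens comp_in_A4
  have "carrier S \<noteq> {\<zero>\<^bsub>S\<^esub>}" using assms(2) by (simp add: simple_module_def)
  then obtain x where x: "x \<in> carrier S" "x \<noteq> \<zero>\<^bsub>S\<^esub>" using S.M.zero_closed by blast
  obtain y where y: "y \<in> carrier S" "y \<noteq> \<zero>\<^bsub>S\<^esub>" "act S a\<^sub>4 y = y"
  proof (cases "act S a\<^sub>4 x = x")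
    case False
    show ?thesis 
      by (rule that[of "x \<oplus>\<^bsub>S\<^esub> act S a\<^sub>4 x"])
        (use x False G in \<open>simp_all add: S.act_add S.act_act A4_relations S.add_eq_zero_iff S.M.a_comm\<close>)
  qed (use x that in auto)
  obtain z where z: "z \<in> carrier S" "z \<noteq> \<zero>\<^bsub>S\<^esub>" "act S a\<^sub>4 z = z" "act S b\<^sub>4 z = z"
  proof (cases "act S b\<^sub>4 y = y")
    case False
    have "act S a\<^sub>4 (act S b\<^sub>4 y) = act S b\<^sub>4 (act S a\<^sub>4 y)"
      using S.act_act[of b\<^sub>4 a\<^sub>4 y] S.act_act[of a\<^sub>4 b\<^sub>4 y] y(1) G unfolding A4_relations by metis
    then have "act S a\<^sub>4 (act S b\<^sub>4 y) = act S b\<^sub>4 y" using y by simp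
    then show ?thesis 
      by (intro that[of "y \<oplus>\<^bsub>S\<^esub> act S b\<^sub>4 y"])
        (use y False G in \<open>simp_all add: S.act_add S.act_act A4_relations S.add_eq_zero_iff S.M.a_comm\<close>)
  qed (use y that in auto)
  define gz where "gz = act S g\<^sub>4 z"
  define ggz where "ggz = act S g\<^sub>4 gz"
  have gs: "gz \<in> carrier S" "ggz \<in> carrier S" using z G by (auto simp: gz_def ggz_def)
  have V4_fixed: "act S a\<^sub>4 (act S g\<^sub>4 u) = act S g\<^sub>4 u" "act S b\<^sub>4 (act S g\<^sub>4 u) = act S g\<^sub>4 u" 
    if "u \<in> carrier S" "act S a\<^sub>4 u = u" "act S b\<^sub>4 u = u" for u
  proof -
    have "act S (a\<^sub>4 \<circ> g\<^sub>4) u = act S g\<^sub>4 u"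
      using S.act_act[of g\<^sub>4 b\<^sub>4 u] that G by (simp add: A4_relations)
    then show 1: "act S a\<^sub>4 (act S g\<^sub>4 u) = act S g\<^sub>4 u"
      using that G by (simp add: S.act_act)
    have "act S (b\<^sub>4 \<circ> g\<^sub>4) u = act S g\<^sub>4 (act S (a\<^sub>4 \<circ> b\<^sub>4) u)"
      using S.act_act[of g\<^sub>4 "a\<^sub>4 \<circ> b\<^sub>4" u] that G by (simp add: S.V4_table)
    also have "act S (a\<^sub>4 \<circ> b\<^sub>4) u = u" 
      using S.act_act[of a\<^sub>4 b\<^sub>4 u] that G by simp
    finally show "act S b\<^sub>4 (act S g\<^sub>4 u) = act S g\<^sub>4 u" 
      using that G S.act_act[of b\<^sub>4 g\<^sub>4 u] by metis
  qed
  define e where "e \<psi> = S.eigen_proj \<psi> z" for \<psi>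
  have e_eq: "e \<psi> = z \<oplus>\<^bsub>S\<^esub> scal S (\<psi>\<^sup>2) gz \<oplus>\<^bsub>S\<^esub> scal S \<psi> ggz" for \<psi>
    by (simp add: e_def S.eigen_proj_def gz_def ggz_def)
  have e: "e \<psi> \<in> carrier S" "act S a\<^sub>4 (e \<psi>) = e \<psi>" "act S b\<^sub>4 (e \<psi>) = e \<psi>" for \<psi>
    using z gs G V4_fixed[of z, folded gz_def] V4_fixed[of gz, folded ggz_def] 
    by (auto simp: e_eq S.act_add S.act_scal)
  have "\<omega> * \<omega> * \<omega> = 1" using \<omega> by (simp add: power3_eq_cube)
  then have "(\<omega> - 1) * (1 + \<omega> + \<omega>\<^sup>2) = 0" by (simp add: algebra_simps power2_eq_square)
  then have sum0: "1 + \<omega> + \<omega>\<^sup>2 = 0" using \<omega> by simp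
  have "\<omega>\<^sup>2 ^ 2 = \<omega>" using \<open>\<omega> * \<omega> * \<omega> = 1\<close> by (simp add: power2_eq_square mult.assoc)
  then have "e 1 \<oplus>\<^bsub>S\<^esub> e \<omega> \<oplus>\<^bsub>S\<^esub> e (\<omega>\<^sup>2) = (z \<oplus>\<^bsub>S\<^esub> (z \<oplus>\<^bsub>S\<^esub> z)) \<oplus>\<^bsub>S\<^esub> scal S (1 + \<omega> + \<omega>\<^sup>2) gz \<oplus>\<^bsub>S\<^esub> scal S (1 + \<omega> + \<omega>\<^sup>2) ggz"
    using z gs by (simp only: e_eq S.scal_add_left) (simp add: S.M.a_ac S.add_cancel2)
  then have "e 1 \<oplus>\<^bsub>S\<^esub> e \<omega> \<oplus>\<^bsub>S\<^esub> e (\<omega>\<^sup>2) = z" using z gs by (simp add: sum0)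
  then have "\<not> (e 1 = \<zero>\<^bsub>S\<^esub> \<and> e \<omega> = \<zero>\<^bsub>S\<^esub> \<and> e (\<omega>\<^sup>2) = \<zero>\<^bsub>S\<^esub>)" using z(2) by auto
  then obtain \<psi> where \<psi>: "\<psi> \<in> {1, \<omega>, \<omega>\<^sup>2}" "e \<psi> \<noteq> \<zero>\<^bsub>S\<^esub>" by auto
  have "(\<omega>\<^sup>2) ^ 3 = (\<omega> ^ 3)\<^sup>2" by (simp flip: power_mult)
  then have "\<psi> ^ 3 = 1" using \<psi>(1) \<omega> by auto
  then have eg: "act S g\<^sub>4 (e \<psi>) = scal S \<psi> (e \<psi>)" unfolding e_def using z(1) by (rule S.act_eigen_proj[rotated])
  let ?H = "range (\<lambda>c. scal S c (e \<psi>))"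
  have "submodule ?H kA4 S"
  proof (rule S.submoduleI)
    show "\<zero>\<^bsub>S\<^esub> \<in> ?H" using S.scal_0[OF e(1)] by (metis rangeI)
  qed (use e eg G in \<open>auto simp: S.scal_add_left[symmetric] S.scal_scal S.act_scal\<close>)
  moreover have "e \<psi> \<in> ?H" using S.scal_one[OF e(1)] by (metis rangeI)
  ultimately have "?H = carrier S" using assms(2) \<psi>(2) unfolding simple_module_def by blast
  then have "A4_module \<psi> S"
    using e eg \<psi>(2) by (intro A4_moduleI[OF assms(1), of "e \<psi>"]) auto
  then show ?thesis using \<psi>(1) by blast
qed

section \<open>Eigenspaces in subquotients\<close>

text \<open>The factor module \<open>H'/H\<close>, with all statements about it brought back to the elements of \<open>H'\<close>.\<close>

locale kA4_subquotient = kA4_module M for M :: "((nat \<Rightarrow> nat) \<Rightarrow> 'k::field, 'm) module" (structure) +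
  fixes H H'
  assumes H: "submodule H kA4 M" and H': "submodule H' kA4 M" and sub: "H \<subseteq> H'"
begin

abbreviation Q where "Q \<equiv> lmod_quotient (M\<lparr>carrier := H'\<rparr>) H"

definition cls :: "'m \<Rightarrow> 'm set" where "cls x = (\<lambda>h. h \<oplus>\<^bsub>M\<^esub> x) ` H"

lemma H_closed: "x \<in> H \<Longrightarrow> x \<in> carrier M" and H'_closed: "x \<in> H' \<Longrightarrow> x \<in> carrier M"
  using submoduleD(1)[OF H] submoduleD(1)[OF H'] by auto

lemma smult_H: "r \<in> carrier kA4 \<Longrightarrow> x \<in> H \<Longrightarrow> r \<odot>\<^bsub>M\<^esub> x \<in> H"
  and smult_H': "r \<in> carrier kA4 \<Longrightarrow> x \<in> H' \<Longrightarrow> r \<odot>\<^bsub>M\<^esub> x \<in> H'"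
  using submodule.smult_closed[OF H] submodule.smult_closed[OF H'] by auto

lemma cls_subset:
  assumes x: "x \<in> H'" and y: "y \<in> H'" and xy: "x \<oplus>\<^bsub>M\<^esub> y \<in> H"
  shows "cls x \<subseteq> cls y"
proof
  fix z assume "z \<in> cls x"
  then obtain h where h: "h \<in> H" "z = h \<oplus>\<^bsub>M\<^esub> x" by (auto simp: cls_def)
  have c: "h \<in> carrier M" "x \<in> carrier M" "y \<in> carrier M" using h x y H_closed H'_closed by auto
  have "z = (h \<oplus>\<^bsub>M\<^esub> (x \<oplus>\<^bsub>M\<^esub> y)) \<oplus>\<^bsub>M\<^esub> y" using c h by (simp add: M.a_assoc)
  then show "z \<in> cls y" using submoduleD(3)[OF H h(1) xy] by (auto simp: cls_def)
qed

lemma cls_eq_iff: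
  assumes x: "x \<in> H'" and y: "y \<in> H'" 
  shows "cls x = cls y \<longleftrightarrow> x \<oplus>\<^bsub>M\<^esub> y \<in> H"
proof
  have c: "x \<in> carrier M" "y \<in> carrier M" using x y H'_closed by auto
  assume "cls x = cls y"
  moreover have "x \<in> cls x" using submoduleD(2)[OF H] c by (force simp: cls_def)
  ultimately obtain h where h: "h \<in> H" "x = h \<oplus>\<^bsub>M\<^esub> y" by (auto simp: cls_def)
  then have "x \<oplus>\<^bsub>M\<^esub> y = h" using c H_closed[of h] by (simp add: M.a_assoc)
  then show "x \<oplus>\<^bsub>M\<^esub> y \<in> H" using h by simp
next
  assume xy: "x \<oplus>\<^bsub>M\<^esub> y \<in> H"
  then have "y \<oplus>\<^bsub>M\<^esub> x \<in> H" using x y H'_closed by (simp add: M.a_comm)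
  then show "cls x = cls y" using cls_subset x y xy by blast
qed

lemma coset_cls: "H +>\<^bsub>M\<lparr>carrier := H'\<rparr>\<^esub> x = cls x"
  by (auto simp: a_r_coset_def' cls_def)

lemma Q_carrier: "carrier Q = cls ` H'"
  by (auto simp: lmod_quotient_def A_RCOSETS_def' coset_cls)

lemma Q_zero: "\<zero>\<^bsub>Q\<^esub> = cls \<zero>\<^bsub>M\<^esub>"
  using H_closed by (force simp: lmod_quotient_def cls_def)

lemma Q_add:
  assumes x: "x \<in> H'" and y: "y \<in> H'" 
  shows "cls x \<oplus>\<^bsub>Q\<^esub> cls y = cls (x \<oplus>\<^bsub>M\<^esub> y)"
proof -
  have c: "x \<in> carrier M" "y \<in> carrier M" using x y H'_closed by auto
  have "cls x \<oplus>\<^bsub>Q\<^esub> cls y = {z. \<exists>h\<in>H. \<exists>k\<in>H. z = (h \<oplus>\<^bsub>M\<^esub> x) \<oplus>\<^bsub>M\<^esub> (k \<oplus>\<^bsub>M\<^esub> y)}"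
    by (auto simp: lmod_quotient_def set_add_def' cls_def)
  also have "\<dots> = {z. \<exists>h\<in>H. \<exists>k\<in>H. z = (h \<oplus>\<^bsub>M\<^esub> k) \<oplus>\<^bsub>M\<^esub> (x \<oplus>\<^bsub>M\<^esub> y)}"
    using c H_closed by (auto simp: M.a_ac intro!: bexI)
  also have "\<dots> = cls (x \<oplus>\<^bsub>M\<^esub> y)"
  proof -
    have "\<exists>h\<in>H. \<exists>k\<in>H. l = h \<oplus>\<^bsub>M\<^esub> k" if "l \<in> H" for l
      using that submoduleD(2)[OF H] H_closed by (metis M.r_zero)
    then show ?thesis using submoduleD(3)[OF H] by (auto simp: cls_def) blast
  qed
  finally show ?thesis .
qed

lemma Q_smult:
  assumes r: "r \<in> carrier kA4" and x: "x \<in> H'"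
  shows "r \<odot>\<^bsub>Q\<^esub> cls x = cls (r \<odot>\<^bsub>M\<^esub> x)"
proof -
  have "cls (r \<odot>\<^bsub>M\<^esub> z) = cls (r \<odot>\<^bsub>M\<^esub> x)" if z: "z \<in> cls x" for z
  proof -
    obtain h where h: "h \<in> H" "z = h \<oplus>\<^bsub>M\<^esub> x" using z by (auto simp: cls_def)
    have c: "h \<in> carrier M" "x \<in> carrier M" using h x H_closed H'_closed by auto
    have z': "z \<in> H'" using h sub x submoduleD(3)[OF H'] by auto
    have "r \<odot>\<^bsub>M\<^esub> z \<oplus>\<^bsub>M\<^esub> r \<odot>\<^bsub>M\<^esub> x = r \<odot>\<^bsub>M\<^esub> h"
      using c h r by (simp add: smult_r_distr smult_closed M.a_assoc)
    then show ?thesis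
      using smult_H[OF r h(1)] smult_H'[OF r z'] smult_H'[OF r x] by (simp add: cls_eq_iff)
  qed
  moreover have "x \<in> cls x" using submoduleD(2)[OF H] x H'_closed by (force simp: cls_def)
  ultimately have "(\<Union>z\<in>cls x. cls (r \<odot>\<^bsub>M\<^esub> z)) = cls (r \<odot>\<^bsub>M\<^esub> x)" by blast
  then show ?thesis by (simp add: lmod_quotient_def coset_cls)
qed

lemma Q_module: "kA4_module Q"
proof -
  note Hc = H'_closed submoduleD(2,3)[OF H'] smult_H'
  have "abelian_group Q"
  proof (rule abelian_groupI)
    fix x assume "x \<in> carrier Q"
    then obtain u where u: "u \<in> H'" "x = cls u" by (auto simp: Q_carrier)
    then have "x \<oplus>\<^bsub>Q\<^esub> x = \<zero>\<^bsub>Q\<^esub>" using Hc by (simp add: Q_add Q_zero)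
    then show "\<exists>y\<in>carrier Q. y \<oplus>\<^bsub>Q\<^esub> x = \<zero>\<^bsub>Q\<^esub>" using u Q_carrier by blast
  qed (use Hc in \<open>auto simp: Q_carrier Q_add Q_zero M.a_ac\<close>)
  moreover have "left_module_axioms kA4 Q"
    by unfold_locales
      (use Hc in \<open>auto simp: Q_carrier Q_add Q_smult smult_l_distr smult_r_distr smult_assoc smult_one
        R.add.m_closed R.m_closed R.one_closed\<close>)
  ultimately have "left_module kA4 Q" by (intro left_module.intro R.ring_axioms)
  then show ?thesis using two by (simp add: kA4_module_def kA4_module_axioms_def)
qed

lemma Q_scal: "x \<in> H' \<Longrightarrow> scal Q c (cls x) = cls (scal M c x)"
  and Q_act: "x \<in> H' \<Longrightarrow> s \<in> carrier A4 \<Longrightarrow> act Q s (cls x) = cls (act M s x)"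
  by (simp_all add: scal_def act_def Q_smult mon_carrier A4_gens)

lemma cls_zero_iff: "x \<in> H' \<Longrightarrow> cls x = \<zero>\<^bsub>Q\<^esub> \<longleftrightarrow> x \<in> H"
  using submoduleD(2)[OF H'] H'_closed by (simp add: Q_zero cls_eq_iff)

lemmas H'_intros = submoduleD(2-5)[OF H']

lemma Q_A4_moduleI:
  assumes x: "x \<in> H'" "x \<notin> H" and span: "\<And>y. y \<in> H' \<Longrightarrow> \<exists>c. y \<oplus>\<^bsub>M\<^esub> scal M c x \<in> H"
    and "act M a\<^sub>4 x \<oplus>\<^bsub>M\<^esub> x \<in> H" "act M b\<^sub>4 x \<oplus>\<^bsub>M\<^esub> x \<in> H" "act M g\<^sub>4 x \<oplus>\<^bsub>M\<^esub> scal M \<chi> x \<in> H"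
  shows "A4_module \<chi> Q"
  by (rule A4_moduleI[OF Q_module, of "cls x"])
    (use assms in \<open>auto simp: Q_carrier cls_zero_iff Q_scal Q_act cls_eq_iff H'_intros A4_gens\<close>)

lemma Q_A4_moduleD:
  assumes "A4_module \<chi> Q"
  obtains x where "x \<in> H'" "x \<notin> H" "\<And>y. y \<in> H' \<Longrightarrow> \<exists>c. y \<oplus>\<^bsub>M\<^esub> scal M c x \<in> H"
    "\<And>y. y \<in> H' \<Longrightarrow> act M g\<^sub>4 y \<oplus>\<^bsub>M\<^esub> scal M \<chi> y \<in> H"
proof -
  from assms obtain t where t: "t \<in> carrier Q" "t \<noteq> \<zero>\<^bsub>Q\<^esub>"
    "\<And>x. x \<in> carrier Q \<Longrightarrow> \<exists>c. x = scal Q c t"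
    "\<And>x. x \<in> carrier Q \<Longrightarrow> act Q g\<^sub>4 x = scal Q \<chi> x" by (rule A4_moduleD) blast
  then obtain x where x: "x \<in> H'" "t = cls x" by (auto simp: Q_carrier)
  show ?thesis
  proof (rule that[OF x(1)])
    show "x \<notin> H" using x t cls_zero_iff by auto
    show "\<exists>c. y \<oplus>\<^bsub>M\<^esub> scal M c x \<in> H" if "y \<in> H'" for y
      using t(3)[of "cls y"] that x by (auto simp: Q_carrier Q_scal cls_eq_iff H'_intros)
    show "act M g\<^sub>4 y \<oplus>\<^bsub>M\<^esub> scal M \<chi> y \<in> H" if "y \<in> H'" for y
      using t(4)[of "cls y"] that by (auto simp: Q_carrier Q_scal Q_act cls_eq_iff H'_intros A4_gens)
  qed
qed

text \<open>A generator of the factor lifts to an eigenvector of \<open>g\<close>: the eigenprojection of an arbitrary lift is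
  congruent to it modulo \<open>H\<close>.\<close>

lemma Q_eigen_same:
  assumes "A4_module \<psi> Q" and \<psi>: "\<psi> ^ 3 = 1"
  obtains x where "x \<in> H'" "x \<notin> H" "act M g\<^sub>4 x = scal M \<psi> x"
    "\<And>y. y \<in> H' \<Longrightarrow> \<exists>c. y \<oplus>\<^bsub>M\<^esub> scal M c x \<in> H"
proof -
  from assms(1) obtain x where x: "x \<in> H'" "x \<notin> H"
    and span: "\<And>y. y \<in> H' \<Longrightarrow> \<exists>c. y \<oplus>\<^bsub>M\<^esub> scal M c x \<in> H"
    and g: "act M g\<^sub>4 x \<oplus>\<^bsub>M\<^esub> scal M \<psi> x \<in> H" by (rule Q_A4_moduleD) blast
  note HI = submoduleD(2-5)[OF H]
  have xM: "x \<in> carrier M" using x H'_closed by auto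
  let ?h1 = "act M g\<^sub>4 x \<oplus>\<^bsub>M\<^esub> scal M \<psi> x"
  define h where "h = scal M (\<psi>\<^sup>2) ?h1 \<oplus>\<^bsub>M\<^esub> scal M \<psi> (act M g\<^sub>4 ?h1 \<oplus>\<^bsub>M\<^esub> scal M \<psi> ?h1)"
  have hH: "h \<in> H" unfolding h_def
    by (rule HI(2)[OF HI(3)[OF g] HI(3)[OF HI(2)[OF HI(4)[OF g A4_gens(4)] HI(3)[OF g]]]])
  have "\<psi>\<^sup>2 * \<psi> = 1" "\<psi> * (\<psi> * \<psi>) = 1" "\<psi> * \<psi> = \<psi>\<^sup>2" using \<psi> by (simp_all add: power2_eq_square power3_eq_cube mult.assoc)
  moreover have "scal M (\<psi>\<^sup>2) (act M g\<^sub>4 x) \<oplus>\<^bsub>M\<^esub> (scal M (\<psi>\<^sup>2) (act M g\<^sub>4 x) \<oplus>\<^bsub>M\<^esub> z) = z" if "z \<in> carrier M" for z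
    using that xM by (simp add: add_cancel2 A4_gens)
  ultimately have "eigen_proj \<psi> x = x \<oplus>\<^bsub>M\<^esub> h"
    using xM A4_gens by (simp add: h_def eigen_proj_def scal_add act_add act_scal scal_scal add_cancel2 M.a_ac)
  then have e: "eigen_proj \<psi> x \<oplus>\<^bsub>M\<^esub> x = h" "eigen_proj \<psi> x = h \<oplus>\<^bsub>M\<^esub> x"
    using xM H_closed[OF hH] by (simp_all add: M.a_ac)
  have eH: "eigen_proj \<psi> x \<in> H'" unfolding e(2) using hH sub x by (intro H'_intros) auto
  show ?thesis
  proof (rule that[OF eH _ act_eigen_proj[OF xM \<psi>]])
    show "eigen_proj \<psi> x \<notin> H"
    proof
      assume "eigen_proj \<psi> x \<in> H"
      then have "h \<oplus>\<^bsub>M\<^esub> eigen_proj \<psi> x \<in> H" using hH HI by auto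
      then show False using e xM H_closed[OF hH] x(2) by (simp add: add_cancel2)
    qed
    show "\<exists>c. y \<oplus>\<^bsub>M\<^esub> scal M c (eigen_proj \<psi> x) \<in> H" if y: "y \<in> H'" for y
    proof -
      obtain c where c: "y \<oplus>\<^bsub>M\<^esub> scal M c x \<in> H" using span[OF y] by blast
      have "y \<oplus>\<^bsub>M\<^esub> scal M c (eigen_proj \<psi> x) = (y \<oplus>\<^bsub>M\<^esub> scal M c x) \<oplus>\<^bsub>M\<^esub> scal M c h"
        using xM H_closed[OF hH] H'_closed[OF y] unfolding e(2) by (simp add: scal_add M.a_ac)
      then show ?thesis using c hH HI by metis
    qed
  qed
qed

text \<open>Modulo \<open>H\<close>, the vector \<open>y\<close> is an eigenvector for two different eigenvalues, hence zero.\<close>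

lemma Q_eigen_other:
  assumes "A4_module \<chi> Q" "\<chi> \<noteq> \<psi>" and y: "y \<in> H'" "act M g\<^sub>4 y = scal M \<psi> y"
  shows "y \<in> H"
proof -
  have "act M g\<^sub>4 y \<oplus>\<^bsub>M\<^esub> scal M \<chi> y \<in> H" by (rule Q_A4_moduleD[OF assms(1)]) (use y in blast)
  then have "scal M (\<psi> + \<chi>) y \<in> H" using y H'_closed by (simp add: scal_add_left)
  then have "scal M (1 / (\<psi> + \<chi>)) (scal M (\<psi> + \<chi>) y) \<in> H" by (rule submoduleD(4)[OF H])
  moreover have "\<psi> + \<chi> \<noteq> 0" using assms(2) char2' by (metis eq_neg_iff_add_eq_0)
  ultimately show ?thesis using y H'_closed by (simp add: scal_scal)
qed

end

section \<open>Dimensions of spaces of coordinates\<close>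

text \<open>Vectors chosen at the indices where the chain grows form a basis of its last member.\<close>

lemma (in vector_space) dim_chain:
  assumes V0: "V 0 = {0}" and sub: "\<And>i. i \<le> n \<Longrightarrow> subspace (V i)"
    and mono: "\<And>i. i < n \<Longrightarrow> V i \<subseteq> V (Suc i)"
    and up: "\<And>i. i < n \<Longrightarrow> P i \<Longrightarrow> \<exists>x\<in>V (Suc i) - V i. \<forall>y\<in>V (Suc i). \<exists>c. y - scale c x \<in> V i"
    and stay: "\<And>i. i < n \<Longrightarrow> \<not> P i \<Longrightarrow> V (Suc i) \<subseteq> V i"
  shows "dim (V n) = card {i. i < n \<and> P i}"
proof -
  have "\<exists>B. finite B \<and> independent B \<and> B \<subseteq> V m \<and> V m \<subseteq> span B \<and> card B = card {i. i < m \<and> P i}"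
    if "m \<le> n" for m
    using that
  proof (induction m)
    case 0
    then show ?case using V0 by (intro exI[of _ "{}"]) (auto simp: span_empty independent_empty)
  next
    case (Suc m)
    then obtain B where B: "finite B" "independent B" "B \<subseteq> V m" "V m \<subseteq> span B"
      "card B = card {i. i < m \<and> P i}" by auto
    show ?case
    proof (cases "P m")
      case False
      then have "{i. i < Suc m \<and> P i} = {i. i < m \<and> P i}" by (auto simp: less_Suc_eq)
      then show ?thesis using B stay[of m] mono[of m] False Suc.prems by (intro exI[of _ B]) auto
    next
      case True
      then obtain x where x: "x \<in> V (Suc m)" "x \<notin> V m" "\<And>y. y \<in> V (Suc m) \<Longrightarrow> \<exists>c. y - scale c x \<in> V m"
        using up[of m] Suc.prems by auto
      have "span B \<subseteq> V m" using B(3) sub[of m] Suc.prems by (intro span_minimal) auto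
      then have "x \<notin> span B" using x by auto
      then have "independent (insert x B)" "x \<notin> B" using B independent_insertI span_base by auto
      moreover have "V (Suc m) \<subseteq> span (insert x B)"
        using x(3) B(4) span_breakdown_eq by blast
      moreover have "{i. i < Suc m \<and> P i} = insert m {i. i < m \<and> P i}" using True by (auto simp: less_Suc_eq)
      ultimately show ?thesis using B mono[of m] x(1) Suc.prems
        by (intro exI[of _ "insert x B"]) auto
    qed
  qed
  then show ?thesis using dim_unique by blast
qed

definition scale4 :: "'k::field \<Rightarrow> 'k \<times> 'k \<times> 'k \<times> 'k \<Rightarrow> 'k \<times> 'k \<times> 'k \<times> 'k"
  where "scale4 c = (\<lambda>(\<alpha>, \<beta>, \<gamma>, \<delta>). (c * \<alpha>, c * \<beta>, c * \<gamma>, c * \<delta>))"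

interpretation V: vector_space "scale4 :: 'k::field \<Rightarrow> _"
  by unfold_locales (auto simp: scale4_def algebra_simps split: prod.splits)

text \<open>The conditions on \<open>\<alpha>\<close> and on \<open>(\<beta>, \<gamma>, \<delta>)\<close> are independent. The former leaves \<open>\<alpha>\<close> free or forces it to be 0.
  In the latter, the cyclic permutation of three coordinates has each cube root of unity \<open>\<rho> = \<psi> / \<chi>\<close> as eigenvalue exactly once, with
  eigenvector \<open>(1, \<rho>, \<rho>\<^sup>2)\<close>.\<close>

lemma dim_eigen:
  fixes \<chi> \<psi> :: "'k::field"
  assumes \<chi>: "\<chi> ^ 3 = 1" and \<psi>: "\<psi> ^ 3 = 1"
  shows "V.dim {(\<alpha>, \<beta>, \<gamma>, \<delta>). \<chi> * \<alpha> = \<psi> * \<alpha> \<and> \<chi> * \<gamma> = \<psi> * \<beta> \<and> \<chi> * \<delta> = \<psi> * \<gamma> \<and> \<chi> * \<beta> = \<psi> * \<delta>}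
    = (if \<chi> = \<psi> then 2 else 1)" (is "V.dim ?E = _")
proof -
  define \<rho> where "\<rho> = \<psi> / \<chi>"
  have \<chi>0: "\<chi> \<noteq> 0" and \<psi>0: "\<psi> \<noteq> 0" using \<chi> \<psi> by auto
  have \<rho>: "\<rho> * \<chi> = \<psi>" "\<rho> * (\<rho> * \<rho>) = 1"
    using \<chi> \<psi> \<chi>0 by (simp_all add: \<rho>_def field_simps power3_eq_cube)
  have E: "?E = {(\<alpha>, \<beta>, \<gamma>, \<delta>). (\<chi> = \<psi> \<or> \<alpha> = 0) \<and> \<gamma> = \<rho> * \<beta> \<and> \<delta> = \<rho> * \<rho> * \<beta>}"
    (is "_ = ?F")
  proof -
    have "\<chi> * x = \<psi> * y \<longleftrightarrow> x = \<rho> * y" for x y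
      using \<chi>0 by (auto simp: \<rho>_def field_simps)
    moreover have "\<rho> * (\<rho> * (\<rho> * x)) = x" for x using \<rho>(2) by (metis mult.assoc mult_1)
    ultimately show ?thesis by (auto simp: mult.assoc)
  qed
  define v where "v = (0::'k, 1::'k, \<rho>, \<rho> * \<rho>)"
  define e where "e = (1::'k, 0::'k, 0::'k, 0::'k)"
  have v0: "v \<noteq> 0" by (simp add: v_def zero_prod_def)
  have iv: "V.independent {v}" using v0 by simp
  show ?thesis
  proof (cases "\<chi> = \<psi>")
    case True
    have "e \<notin> V.span {v}"
      by (auto simp: V.span_singleton e_def v_def scale4_def)
    then have "V.independent {e, v}" "e \<noteq> v" using V.independent_insertI[OF _ iv] V.span_base[of v "{v}"] by auto
    moreover have "?F \<subseteq> V.span {e, v}"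
    proof
      fix u assume "u \<in> ?F"
      then obtain \<alpha> \<beta> where "u = (\<alpha>, \<beta>, \<rho> * \<beta>, \<rho> * \<rho> * \<beta>)" by auto
      then have "u = scale4 \<alpha> e + scale4 \<beta> v"
        by (simp add: e_def v_def scale4_def mult.commute)
      then show "u \<in> V.span {e, v}" by (simp add: V.span_add V.span_scale V.span_base)
    qed
    ultimately show ?thesis unfolding E using True
      by (intro V.dim_unique[of "{e, v}"]) (auto simp: e_def v_def)
  next
    case False
    have "?F \<subseteq> V.span {v}"
    proof
      fix u assume "u \<in> ?F"
      then obtain \<beta> where "u = (0, \<beta>, \<rho> * \<beta>, \<rho> * \<rho> * \<beta>)" using False by auto
      then have "u = scale4 \<beta> v"
        by (simp add: v_def scale4_def mult.commute)
      then show "u \<in> V.span {v}" by (simp add: V.span_scale V.span_base)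
    qed
    then show ?thesis unfolding E using False iv
      by (intro V.dim_unique[of "{v}"]) (auto simp: v_def)
  qed
qed

section \<open>Modules with coordinates given by an eigenvector\<close>

locale kA4_eigenvector = kA4_module M for M :: "((nat \<Rightarrow> nat) \<Rightarrow> 'k::field, 'm) module" (structure) +
  fixes \<chi> :: 'k and p
  assumes p: "p \<in> carrier M" and gp: "act M g\<^sub>4 p = scal M \<chi> p"
begin

abbreviation \<Phi> where "\<Phi> \<equiv> comb M p"

lemma \<Phi>_zero: "\<Phi> 0 = \<zero>\<^bsub>M\<^esub>" using p by (simp add: zero_prod_def)

lemma \<Phi>_scale: "scal M c (\<Phi> u) = \<Phi> (scale4 c u)"
  using p by (cases u) (simp add: comb_scal scale4_def)

lemma submodule_image:
  assumes "0 \<in> U" "\<And>u v. u \<in> U \<Longrightarrow> v \<in> U \<Longrightarrow> u + v \<in> U" "\<And>c u. u \<in> U \<Longrightarrow> scale4 c u \<in> U"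
    and act: "\<And>\<alpha> \<beta> \<gamma> \<delta>. (\<alpha>, \<beta>, \<gamma>, \<delta>) \<in> U \<Longrightarrow> (\<beta>, \<alpha>, \<delta>, \<gamma>) \<in> U \<and> (\<gamma>, \<delta>, \<alpha>, \<beta>) \<in> U \<and> (\<alpha>, \<gamma>, \<delta>, \<beta>) \<in> U"
  shows "submodule (\<Phi> ` U) kA4 M"
proof (rule submoduleI)
  show "\<zero>\<^bsub>M\<^esub> \<in> \<Phi> ` U" using assms(1) \<Phi>_zero by (metis imageI)
  show "x \<oplus>\<^bsub>M\<^esub> y \<in> \<Phi> ` U" if "x \<in> \<Phi> ` U" "y \<in> \<Phi> ` U" for x y
    using that assms(2) p by (auto simp: comb_add)
  show "scal M c x \<in> \<Phi> ` U" if "x \<in> \<Phi> ` U" for x c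
    using that assms(3) by (auto simp: \<Phi>_scale)
  fix x assume "x \<in> \<Phi> ` U"
  then obtain \<alpha> \<beta> \<gamma> \<delta> where u: "(\<alpha>, \<beta>, \<gamma>, \<delta>) \<in> U" "x = \<Phi> (\<alpha>, \<beta>, \<gamma>, \<delta>)" by (metis imageE prod_cases4)
  show "act M a\<^sub>4 x \<in> \<Phi> ` U" "act M b\<^sub>4 x \<in> \<Phi> ` U"
    using act[OF u(1)] p by (auto simp: u(2) comb_act)
  have "act M g\<^sub>4 x = \<Phi> (scale4 \<chi> (\<alpha>, \<gamma>, \<delta>, \<beta>))"
    using p gp by (simp add: u(2) comb_eigen scale4_def)
  then show "act M g\<^sub>4 x \<in> \<Phi> ` U" using act[OF u(1)] assms(3) by auto
qed (use p in auto)

text \<open>The socle of \<open>kV\<^sub>4\<close> is spanned by the sum of all group elements. Concretely, multiplication of a nonzero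
  \<open>u\<close> by \<open>1 + a + b + ab\<close>, by \<open>1 + a\<close>, by \<open>1 + b\<close> or by 1 gives a nonzero constant vector.\<close>

lemma \<Phi>_socle:
  assumes "\<Phi> u = \<zero>\<^bsub>M\<^esub>" "u \<noteq> 0"
  shows "\<Phi> (1, 1, 1, 1) = \<zero>\<^bsub>M\<^esub>"
proof -
  obtain \<alpha> \<beta> \<gamma> \<delta> where u: "u = (\<alpha>, \<beta>, \<gamma>, \<delta>)" by (metis prod_cases4)
  have *: "\<Phi> (1, 1, 1, 1) = \<zero>\<^bsub>M\<^esub>" if "\<Phi> (c, c, c, c) = \<zero>\<^bsub>M\<^esub>" "c \<noteq> 0" for c
    using p that comb_scal[of p "1 / c" c c c c] by simp
  have a: "\<Phi> (\<beta>, \<alpha>, \<delta>, \<gamma>) = \<zero>\<^bsub>M\<^esub>" and b: "\<Phi> (\<gamma>, \<delta>, \<alpha>, \<beta>) = \<zero>\<^bsub>M\<^esub>"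
    using comb_act[OF p] assms(1) u A4_gens by (metis act_zero)+
  have ab: "\<Phi> (\<alpha> + \<beta>, \<alpha> + \<beta>, \<gamma> + \<delta>, \<gamma> + \<delta>) = \<zero>\<^bsub>M\<^esub>"
    using a assms(1) u p comb_add[of p "(\<alpha>, \<beta>, \<gamma>, \<delta>)" "(\<beta>, \<alpha>, \<delta>, \<gamma>)"] by (simp add: add.commute)
  have ac: "\<Phi> (\<alpha> + \<gamma>, \<beta> + \<delta>, \<alpha> + \<gamma>, \<beta> + \<delta>) = \<zero>\<^bsub>M\<^esub>"
    using b assms(1) u p comb_add[of p "(\<alpha>, \<beta>, \<gamma>, \<delta>)" "(\<gamma>, \<delta>, \<alpha>, \<beta>)"] by (simp add: add.commute)
  let ?\<sigma> = "(\<alpha> + \<beta>) + (\<gamma> + \<delta>)"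
  have "act M b\<^sub>4 (\<Phi> (\<alpha> + \<beta>, \<alpha> + \<beta>, \<gamma> + \<delta>, \<gamma> + \<delta>)) = \<zero>\<^bsub>M\<^esub>" using ab A4_gens by simp
  then have "\<Phi> (\<gamma> + \<delta>, \<gamma> + \<delta>, \<alpha> + \<beta>, \<alpha> + \<beta>) = \<zero>\<^bsub>M\<^esub>" using p by (simp add: comb_act)
  then have \<sigma>: "\<Phi> (?\<sigma>, ?\<sigma>, ?\<sigma>, ?\<sigma>) = \<zero>\<^bsub>M\<^esub>"
    using ab p comb_add[of p "(\<alpha> + \<beta>, \<alpha> + \<beta>, \<gamma> + \<delta>, \<gamma> + \<delta>)" "(\<gamma> + \<delta>, \<gamma> + \<delta>, \<alpha> + \<beta>, \<alpha> + \<beta>)"]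
    by (simp add: add.commute)
  have eq: "x + y = 0 \<longleftrightarrow> x = y" for x y :: 'k using char2' by (metis eq_neg_iff_add_eq_0)
  show ?thesis
  proof (cases "?\<sigma> = 0")
    case False then show ?thesis using * \<sigma> by blast
  next
    case True
    then have 1: "\<alpha> + \<beta> = \<gamma> + \<delta>" using eq by blast
    have "(\<alpha> + \<gamma>) + (\<beta> + \<delta>) = 0" using True by (simp add: ac_simps)
    then have 2: "\<alpha> + \<gamma> = \<beta> + \<delta>" using eq by blast
    show ?thesis
    proof (cases "\<alpha> + \<beta> = 0 \<and> \<alpha> + \<gamma> = 0")
      case True
      then have "\<beta> = \<alpha>" "\<gamma> = \<alpha>" "\<delta> = \<alpha>" using 1 2 eq by metis+
      then show ?thesis using * assms u by (auto simp: zero_prod_def)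
    next
      case False
      then show ?thesis using * ab ac 1 2 by metis
    qed
  qed
qed

end

text \<open>Every projective cover of a simple module has this shape; the fixed cube root of unity \<open>\<omega>\<close> serves
  to name the simple modules.\<close>

locale kA4_frame = kA4_eigenvector M \<chi> p
  for M :: "((nat \<Rightarrow> nat) \<Rightarrow> 'k::field, 'm) module" (structure) and \<chi> p +
  fixes \<omega> :: 'k
  assumes surj: "carrier M \<subseteq> range (comb M p)"
    and ker: "\<And>u. comb M p u = \<zero>\<^bsub>M\<^esub> \<Longrightarrow> u = 0"
    and \<chi>: "\<chi> ^ 3 = 1" and \<omega>: "\<omega> ^ 3 = 1" "\<omega> \<noteq> 1"
begin

lemma \<Phi>_eq_iff: "\<Phi> u = \<Phi> v \<longleftrightarrow> u = v"
proof
  assume "\<Phi> u = \<Phi> v"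
  then have "\<Phi> (u + v) = \<zero>\<^bsub>M\<^esub>" using p by (simp add: comb_add[symmetric])
  then have "u + v = 0" by (rule ker)
  moreover have "v + v = 0" by (cases v) (simp add: zero_prod_def char2)
  ultimately show "u = v" by (metis add_right_cancel)
qed simp

text \<open>Pulled back along \<open>\<Phi>\<close>, the \<open>\<psi>\<close>-eigenspaces of the members of the series form a chain that grows by one
  dimension exactly at the factors with eigenvalue \<open>\<psi>\<close>.\<close>

lemma composition_count:
  fixes S :: "((nat \<Rightarrow> nat) \<Rightarrow> 'k, 'n) module"
  assumes Hs: "composition_series kA4 M Hs" and S: "kA4_module S" "A4_module \<psi> S" and \<psi>: "\<psi> ^ 3 = 1"
  shows "card {i. Suc i < length Hs \<and> lmod_isomorphic kA4 (series_factor M Hs i) S} = (if \<chi> = \<psi> then 2 else 1)"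
proof -
  define n where "n = length Hs - 1"
  have len: "length Hs = Suc n" using Hs by (simp add: composition_series_def n_def)
  define P where "P i \<longleftrightarrow> A4_module \<psi> (series_factor M Hs i)" for i
  have subq: "kA4_subquotient M (Hs ! i) (Hs ! Suc i)" if "i < n" for i
    using Hs that len kA4_module_axioms
    by (auto simp: composition_series_def kA4_subquotient_def kA4_subquotient_axioms_def)
  have simp: "simple_module kA4 (series_factor M Hs i)" if "i < n" for i
    using Hs that len by (simp add: composition_series_def)
  have F: "kA4_module (series_factor M Hs i)" if "i < n" for i
    using kA4_subquotient.Q_module[OF subq[OF that]] by (simp add: series_factor_def)
  have other: "\<exists>\<phi>. A4_module \<phi> (series_factor M Hs i) \<and> \<phi> \<noteq> \<psi>" if "i < n" "\<not> P i" for i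
    using simple_imp_A4_module[OF F simp \<omega>] that by (auto simp: P_def)
  have "lmod_isomorphic kA4 (series_factor M Hs i) S \<longleftrightarrow> P i" if "i < n" for i
  proof
    assume "P i" then show "lmod_isomorphic kA4 (series_factor M Hs i) S"
      using A4_module_isomorphic[OF F S(1)] that S(2) by (simp add: P_def)
  next
    assume iso: "lmod_isomorphic kA4 (series_factor M Hs i) S"
    then show "P i" using other[OF that] A4_module_isomorphic_imp_eq[OF F[OF that] S(1) _ S(2) iso] by blast
  qed
  then have "{i. Suc i < length Hs \<and> lmod_isomorphic kA4 (series_factor M Hs i) S} = {i. i < n \<and> P i}"
    using len by auto
  moreover define V where "V i = {u. \<Phi> u \<in> Hs ! i \<and> act M g\<^sub>4 (\<Phi> u) = scal M \<psi> (\<Phi> u)}" for i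
  have "V.dim (V n) = card {i. i < n \<and> P i}"
  proof (rule V.dim_chain)
    have "Hs ! 0 = {\<zero>\<^bsub>M\<^esub>}" using Hs unfolding composition_series_def by (metis hd_conv_nth)
    then show "V 0 = {0}" using ker \<Phi>_zero A4_gens by (auto simp: V_def)
  next
    fix i assume "i \<le> n"
    then have "submodule (Hs ! i) kA4 M" using Hs len by (simp add: composition_series_def)
    note D = submoduleD[OF this]
    show "V.subspace (V i)"
      unfolding V.subspace_def
    proof (intro conjI ballI allI)
      show "0 \<in> V i" using D(2) \<Phi>_zero A4_gens by (simp add: V_def)
      show "u + v \<in> V i" if "u \<in> V i" "v \<in> V i" for u v
        using that D(3)[of "\<Phi> u" "\<Phi> v"] p A4_gens
        by (simp add: V_def comb_add[symmetric] act_add scal_add)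
      show "scale4 c u \<in> V i" if "u \<in> V i" for u c
        using that D(4)[of "\<Phi> u" c] p A4_gens
        by (simp add: V_def \<Phi>_scale[symmetric] act_scal scal_scal mult.commute)
    qed
  next
    fix i assume "i < n"
    then show "V i \<subseteq> V (Suc i)" using Hs len by (auto simp: V_def composition_series_def)
  next
    fix i assume i: "i < n" "P i"
    then interpret Q: kA4_subquotient M "Hs ! i" "Hs ! Suc i" using subq by simp
    obtain x where x: "x \<in> Hs ! Suc i" "x \<notin> Hs ! i" "act M g\<^sub>4 x = scal M \<psi> x"
      and span: "\<And>y. y \<in> Hs ! Suc i \<Longrightarrow> \<exists>c. y \<oplus>\<^bsub>M\<^esub> scal M c x \<in> Hs ! i"
      by (rule Q.Q_eigen_same[of \<psi>]) (use i \<psi> in \<open>auto simp: P_def series_factor_def\<close>)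
    obtain u where u: "x = \<Phi> u" using surj Q.H'_closed[OF x(1)] by blast
    show "\<exists>u\<in>V (Suc i) - V i. \<forall>v\<in>V (Suc i). \<exists>c. v - scale4 c u \<in> V i"
    proof (intro bexI[of _ u] ballI)
      fix v assume v: "v \<in> V (Suc i)"
      then obtain c where c: "\<Phi> v \<oplus>\<^bsub>M\<^esub> scal M c x \<in> Hs ! i" using span by (auto simp: V_def)
      have "- scale4 c u = scale4 c u" by (cases u) (simp add: scale4_def char2')
      then have "v - scale4 c u = v + scale4 c u" by (metis diff_conv_add_uminus)
      then have "\<Phi> (v - scale4 c u) = \<Phi> v \<oplus>\<^bsub>M\<^esub> scal M c x"
        using p by (simp only: u comb_add[symmetric] \<Phi>_scale)
      then show "\<exists>c. v - scale4 c u \<in> V i"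
        using c v x p A4_gens
        by (intro exI[of _ c]) (simp add: V_def act_add act_scal scal_add scal_scal u mult.commute)
    qed (use x u in \<open>auto simp: V_def\<close>)
  next
    fix i assume i: "i < n" "\<not> P i"
    then interpret Q: kA4_subquotient M "Hs ! i" "Hs ! Suc i" using subq by simp
    obtain \<phi> where "A4_module \<phi> (series_factor M Hs i)" "\<phi> \<noteq> \<psi>" using other[OF i] by blast
    then show "V (Suc i) \<subseteq> V i" using Q.Q_eigen_other[of \<phi> \<psi>]
      by (auto simp: V_def series_factor_def)
  qed
  moreover have "Hs ! n = carrier M" using Hs len unfolding composition_series_def by (metis last_conv_nth diff_Suc_1)
  then have "V n = {(\<alpha>, \<beta>, \<gamma>, \<delta>). \<chi> * \<alpha> = \<psi> * \<alpha> \<and> \<chi> * \<gamma> = \<psi> * \<beta> \<and> \<chi> * \<delta> = \<psi> * \<gamma> \<and> \<chi> * \<beta> = \<psi> * \<delta>}"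
    using p gp by (auto simp: V_def comb_eigen comb_scal \<Phi>_eq_iff)
  ultimately show ?thesis using dim_eigen[OF \<chi> \<psi>] by simp
qed

text \<open>A criterion in coordinates for \<open>\<Phi> ` U' / \<Phi> ` U\<close> to be spanned by one vector that is fixed by
  \<open>V\<^sub>4\<close> and is an eigenvector of \<open>g\<close>.\<close>

lemma factor_image:
  assumes U: "submodule (\<Phi> ` U) kA4 M" and U': "submodule (\<Phi> ` U') kA4 M" and "U \<subseteq> U'"
    and x: "(\<alpha>, \<beta>, \<gamma>, \<delta>) \<in> U'" "(\<alpha>, \<beta>, \<gamma>, \<delta>) \<notin> U"
    and span: "\<And>u. u \<in> U' \<Longrightarrow> \<exists>c. u + scale4 c (\<alpha>, \<beta>, \<gamma>, \<delta>) \<in> U"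
    and act: "(\<alpha> + \<beta>, \<alpha> + \<beta>, \<gamma> + \<delta>, \<gamma> + \<delta>) \<in> U" "(\<alpha> + \<gamma>, \<beta> + \<delta>, \<alpha> + \<gamma>, \<beta> + \<delta>) \<in> U"
    and g: "(\<alpha>, \<gamma>, \<delta>, \<beta>) = scale4 \<phi> (\<alpha>, \<beta>, \<gamma>, \<delta>)"
  shows "simple_module kA4 (lmod_quotient (M\<lparr>carrier := \<Phi> ` U'\<rparr>) (\<Phi> ` U))"
proof -
  interpret Q: kA4_subquotient M "\<Phi> ` U" "\<Phi> ` U'"
    using \<open>U \<subseteq> U'\<close> by (intro kA4_subquotient.intro kA4_module_axioms kA4_subquotient_axioms.intro U U' image_mono)
  have mem: "\<Phi> u \<in> \<Phi> ` W \<longleftrightarrow> u \<in> W" for u W by (auto simp: \<Phi>_eq_iff)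
  \<comment> \<open>Since \<open>g p = \<chi> p\<close>, the eigenvalue is \<open>\<chi>\<close> times that of the coordinate permutation.\<close>
  have "act M g\<^sub>4 (\<Phi> (\<alpha>, \<beta>, \<gamma>, \<delta>)) = \<Phi> (scale4 \<chi> (\<alpha>, \<gamma>, \<delta>, \<beta>))"
    using p gp by (simp add: comb_eigen scale4_def)
  also have "\<dots> = scal M (\<chi> * \<phi>) (\<Phi> (\<alpha>, \<beta>, \<gamma>, \<delta>))"
    unfolding g \<Phi>_scale by (simp add: V.scale_scale)
  finally have 1: "act M g\<^sub>4 (\<Phi> (\<alpha>, \<beta>, \<gamma>, \<delta>)) = scal M (\<chi> * \<phi>) (\<Phi> (\<alpha>, \<beta>, \<gamma>, \<delta>))" .
  have "A4_module (\<chi> * \<phi>) (lmod_quotient (M\<lparr>carrier := \<Phi> ` U'\<rparr>) (\<Phi> ` U))"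
  proof (rule Q.Q_A4_moduleI[of "\<Phi> (\<alpha>, \<beta>, \<gamma>, \<delta>)"])
    show "\<exists>c. y \<oplus>\<^bsub>M\<^esub> scal M c (\<Phi> (\<alpha>, \<beta>, \<gamma>, \<delta>)) \<in> \<Phi> ` U" if y: "y \<in> \<Phi> ` U'" for y
      using y span p by (auto simp: \<Phi>_scale comb_add mem)
    show "act M g\<^sub>4 (\<Phi> (\<alpha>, \<beta>, \<gamma>, \<delta>)) \<oplus>\<^bsub>M\<^esub> scal M (\<chi> * \<phi>) (\<Phi> (\<alpha>, \<beta>, \<gamma>, \<delta>)) \<in> \<Phi> ` U"
      using 1 p submoduleD(2)[OF U] by simp
  qed (use x act p in \<open>simp_all add: mem comb_act comb_add add.commute\<close>)
  then show ?thesis by (rule A4_module_simple[OF Q.Q_module])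
qed

text \<open>The series refines the filtration of \<open>kV\<^sub>4\<close> by powers of its augmentation ideal, which consists of the whole
  ring, the ideal itself, the socle and 0. The plane spanned by the socle and the eigenvector \<open>(0, 1, \<omega>, \<omega>\<^sup>2)\<close> of the
  cyclic permutation is inserted between the socle and the ideal.\<close>

lemma composition_series_exists: "\<exists>Hs. composition_series kA4 M Hs"
proof -
  have "\<omega> * \<omega> * \<omega> = 1" using \<omega> by (simp add: power3_eq_cube)
  then have "(\<omega> - 1) * (1 + \<omega> + \<omega> * \<omega>) = 0" by (simp add: algebra_simps)
  then have "1 + \<omega> + \<omega> * \<omega> = 0" using \<omega> by simp
  then have \<omega>2: "\<omega> * \<omega> = 1 + \<omega>" using char2' by (metis add_eq_0_iff)
  then have \<omega>2': "\<omega> * (\<omega> * x) = x + \<omega> * x" for x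
    by (metis mult.assoc distrib_right mult_1)
  have cancel: "x + (x + y) = y" for x y :: 'k using char2[of x] by (simp add: add.assoc[symmetric])
  note field = \<omega>2 \<omega>2' cancel char2 algebra_simps
  \<comment> \<open>In characteristic 2 we have \<open>\<omega>\<^sup>2 = 1 + \<omega>\<close>, which is used to eliminate squares of \<open>\<omega>\<close> throughout.\<close>
  define U1 where "U1 = range (\<lambda>\<alpha>::'k. (\<alpha>, \<alpha>, \<alpha>, \<alpha>))"
  define U2 where "U2 = {(\<alpha>, \<alpha> + \<beta>, \<alpha> + \<omega> * \<beta>, \<alpha> + \<beta> + \<omega> * \<beta>) | \<alpha> \<beta>. True}"
  define U3 where "U3 = {(\<alpha>, \<beta>, \<gamma>, \<delta>) | \<alpha> \<beta> \<gamma> \<delta> :: 'k. \<alpha> + \<beta> + \<gamma> + \<delta> = 0}"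
  have cancel': "x = y + z \<longleftrightarrow> y = x + z" for x y z :: 'k
    using char2[of z] by (metis add.assoc add.right_neutral)
  have U2_mem: "(\<alpha>, \<beta>, \<gamma>, \<delta>) \<in> U2 \<longleftrightarrow> \<gamma> = \<alpha> + \<omega> * (\<alpha> + \<beta>) \<and> \<delta> = \<beta> + \<omega> * (\<alpha> + \<beta>)" for \<alpha> \<beta> \<gamma> \<delta>
    unfolding U2_def
  proof safe
    assume "\<gamma> = \<alpha> + \<omega> * (\<alpha> + \<beta>)" "\<delta> = \<beta> + \<omega> * (\<alpha> + \<beta>)"
    then show "\<exists>x y. (\<alpha>, \<beta>, \<alpha> + \<omega> * (\<alpha> + \<beta>), \<beta> + \<omega> * (\<alpha> + \<beta>)) = (x, x + y, x + \<omega> * y, x + y + \<omega> * y) \<and> True"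
      by (intro exI[of _ \<alpha>] exI[of _ "\<alpha> + \<beta>"]) (simp add: cancel)
  qed (simp_all add: cancel add.assoc)
  have U3_mem: "(\<alpha>, \<beta>, \<gamma>, \<delta>) \<in> U3 \<longleftrightarrow> \<delta> = \<alpha> + \<beta> + \<gamma>" for \<alpha> \<beta> \<gamma> \<delta>
    unfolding U3_def using cancel'[of 0] cancel'[of \<delta> 0] by simp
  have s0: "submodule (\<Phi> ` {0}) kA4 M"
    by (rule submodule_image) (auto simp: zero_prod_def scale4_def)
  have s1: "submodule (\<Phi> ` U1) kA4 M"
    by (rule submodule_image) (auto simp: U1_def zero_prod_def scale4_def)
  have s2: "submodule (\<Phi> ` U2) kA4 M"
    by (rule submodule_image) (auto simp: U2_mem zero_prod_def scale4_def field)
  have s3: "submodule (\<Phi> ` U3) kA4 M"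
    by (rule submodule_image) (auto simp: U3_mem zero_prod_def scale4_def field)
  have s4: "submodule (\<Phi> ` UNIV) kA4 M"
    by (rule submodule_image) auto
  have f0: "simple_module kA4 (lmod_quotient (M\<lparr>carrier := \<Phi> ` U1\<rparr>) (\<Phi> ` {0}))"
  proof (rule factor_image[OF s0 s1, of 1 1 1 1 1])
    show "\<exists>c. u + scale4 c (1, 1, 1, 1) \<in> {0}" if "u \<in> U1" for u
      using that char2 by (auto simp: U1_def scale4_def zero_prod_def intro!: exI[of _ "fst u"])
  qed (auto simp: U1_def zero_prod_def scale4_def char2)
  have sub: "U1 \<subseteq> U2" "U2 \<subseteq> U3" by (auto simp: U1_def U2_mem U3_mem U2_def field)
  have U1_mem: "(\<alpha>, \<beta>, \<gamma>, \<delta>) \<in> U1 \<longleftrightarrow> \<beta> = \<alpha> \<and> \<gamma> = \<alpha> \<and> \<delta> = \<alpha>" for \<alpha> \<beta> \<gamma> \<delta>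
    unfolding U1_def by auto
  have f1: "simple_module kA4 (lmod_quotient (M\<lparr>carrier := \<Phi> ` U2\<rparr>) (\<Phi> ` U1))"
  proof (rule factor_image[OF s1 s2 sub(1), of 0 1 \<omega> "1 + \<omega>" \<omega>])
    fix u assume "u \<in> U2"
    then obtain \<alpha> \<beta> where "u = (\<alpha>, \<alpha> + \<beta>, \<alpha> + \<omega> * \<beta>, \<alpha> + \<beta> + \<omega> * \<beta>)" by (auto simp: U2_def)
    then show "\<exists>c. u + scale4 c (0, 1, \<omega>, 1 + \<omega>) \<in> U1"
      by (intro exI[of _ \<beta>]) (simp add: scale4_def U1_mem field)
  qed (simp_all add: U1_mem U2_mem scale4_def field)
  have f2: "simple_module kA4 (lmod_quotient (M\<lparr>carrier := \<Phi> ` U3\<rparr>) (\<Phi> ` U2))"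
  proof (rule factor_image[OF s2 s3 sub(2), of 0 1 "1 + \<omega>" \<omega> "1 + \<omega>"])
    show "(0, 1, 1 + \<omega>, \<omega>) \<notin> U2" by (simp add: U2_mem)
    fix u assume "u \<in> U3"
    then obtain \<alpha> \<beta> \<gamma> where "u = (\<alpha>, \<beta>, \<gamma>, \<alpha> + \<beta> + \<gamma>)" using U3_mem by (metis prod_cases4)
    then show "\<exists>c. u + scale4 c (0, 1, 1 + \<omega>, \<omega>) \<in> U2"
      \<comment> \<open>The coefficient \<open>c\<close> solves \<open>\<beta> = \<alpha> + y + c\<close> and \<open>\<gamma> = \<alpha> + \<omega> y + \<omega>\<^sup>2 c\<close>, with \<open>y\<close> eliminated.\<close>
      by (intro exI[of _ "\<gamma> + \<alpha> + \<omega> * (\<beta> + \<alpha>)"]) (simp add: scale4_def U2_mem field)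
  qed (simp_all add: U2_mem U3_mem scale4_def field)
  have f3: "simple_module kA4 (lmod_quotient (M\<lparr>carrier := \<Phi> ` UNIV\<rparr>) (\<Phi> ` U3))"
  proof (rule factor_image[OF s3 s4, of 1 0 0 0 1])
    show "\<exists>c. u + scale4 c (1, 0, 0, 0) \<in> U3" for u
      by (cases u, rename_tac \<alpha> \<beta> \<gamma> \<delta>, rule_tac x = "\<alpha> + \<beta> + \<gamma> + \<delta>" in exI) (simp add: scale4_def U3_mem field)
  qed (simp_all add: U3_mem scale4_def char2)
  let ?Hs = "[\<Phi> ` {0}, \<Phi> ` U1, \<Phi> ` U2, \<Phi> ` U3, \<Phi> ` UNIV]"
  have "\<Phi> ` {0} = {\<zero>\<^bsub>M\<^esub>}" using \<Phi>_zero by simp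
  moreover have "\<Phi> ` UNIV = carrier M" using surj p by auto
  ultimately have "composition_series kA4 M ?Hs"
    using s0 s1 s2 s3 s4 f0 f1 f2 f3 sub submoduleD(2)[OF s1]
    by (auto simp: composition_series_def series_factor_def less_Suc_eq)
  then show ?thesis by blast
qed

lemma composition_multiplicity_eq:
  fixes S :: "((nat \<Rightarrow> nat) \<Rightarrow> 'k, 'n) module"
  assumes "kA4_module S" "A4_module \<psi> S" "\<psi> ^ 3 = 1"
  shows "composition_multiplicity kA4 S M = (if \<chi> = \<psi> then 2 else 1)"
  unfolding composition_multiplicity_def
  using composition_series_exists composition_count[OF _ assms] by (intro the_equality) auto

end

section \<open>Projective covers\<close>

lemma free_kA4_module:
  assumes R: "ring (kA4 :: ((nat \<Rightarrow> nat) \<Rightarrow> 'k) ring)" and two: "(1::'k::field) + 1 = 0"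
  shows "kA4_module (free_lmodule (kA4 :: ((nat \<Rightarrow> nat) \<Rightarrow> 'k) ring) I)" (is "kA4_module ?F")
proof -
  interpret R: ring "kA4 :: ((nat \<Rightarrow> nat) \<Rightarrow> 'k) ring" by fact
  have char2: "c + c = 0" for c :: 'k using two by (metis distrib_left mult.right_neutral mult_zero_right)
  have F: "u \<in> carrier ?F \<longleftrightarrow> (\<forall>i. u i \<in> carrier kA4) \<and> (\<forall>i. i \<notin> I \<longrightarrow> u i = \<zero>\<^bsub>kA4\<^esub>) \<and> finite {i. u i \<noteq> \<zero>\<^bsub>kA4\<^esub>}" for u
    by (simp add: free_lmodule_def)
  have add: "u \<oplus>\<^bsub>?F\<^esub> v \<in> carrier ?F" if "u \<in> carrier ?F" "v \<in> carrier ?F" for u v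
  proof -
    have "{i. (u \<oplus>\<^bsub>?F\<^esub> v) i \<noteq> \<zero>\<^bsub>kA4\<^esub>} \<subseteq> {i. u i \<noteq> \<zero>\<^bsub>kA4\<^esub>} \<union> {i. v i \<noteq> \<zero>\<^bsub>kA4\<^esub>}"
      by (auto simp: free_lmodule_def)
    then have "finite {i. (u \<oplus>\<^bsub>?F\<^esub> v) i \<noteq> \<zero>\<^bsub>kA4\<^esub>}" by (rule finite_subset) (use that in \<open>auto simp: F\<close>)
    then show ?thesis using that unfolding F by (auto simp: free_lmodule_def)
  qed
  have smult: "r \<odot>\<^bsub>?F\<^esub> u \<in> carrier ?F" if "r \<in> carrier kA4" "u \<in> carrier ?F" for r u
  proof -
    have "{i. (r \<odot>\<^bsub>?F\<^esub> u) i \<noteq> \<zero>\<^bsub>kA4\<^esub>} \<subseteq> {i. u i \<noteq> \<zero>\<^bsub>kA4\<^esub>}"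
      using that by (auto simp: free_lmodule_def)
    then have "finite {i. (r \<odot>\<^bsub>?F\<^esub> u) i \<noteq> \<zero>\<^bsub>kA4\<^esub>}" by (rule finite_subset) (use that in \<open>auto simp: F\<close>)
    then show ?thesis using that unfolding F by (auto simp: free_lmodule_def)
  qed
  have "abelian_group ?F"
  proof (rule abelian_groupI)
    fix u assume "u \<in> carrier ?F"
    moreover have "u \<oplus>\<^bsub>?F\<^esub> u = \<zero>\<^bsub>?F\<^esub>"
      by (simp add: free_lmodule_def kA4_add kA4_zero char2)
    ultimately show "\<exists>v\<in>carrier ?F. v \<oplus>\<^bsub>?F\<^esub> u = \<zero>\<^bsub>?F\<^esub>" by blast
  qed (use add in \<open>auto simp: free_lmodule_def kA4_add kA4_zero ac_simps kA4_carrier\<close>)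
  moreover have "left_module_axioms kA4 ?F"
    by unfold_locales
     (use smult in \<open>auto simp: free_lmodule_def fun_eq_iff R.l_distr R.r_distr R.m_assoc\<close>)
  ultimately have "left_module kA4 ?F" by (intro left_module.intro R)
  then show ?thesis using two by (simp add: kA4_module_def kA4_module_axioms_def)
qed

text \<open>The permutations fixing the point 4 form a transversal of the cosets \<open>V\<^sub>4 x\<close>. A family \<open>w\<close> whose coefficients add up to zero over
  each coset is \<open>\<Sum>v. (v + 1) w\<^sub>v\<close>, where \<open>w\<^sub>v\<close> collects at each
  representative \<open>x\<close> the coefficient at \<open>v x\<close>.\<close>

lemma free_norm_zero:
  fixes w :: "'i \<Rightarrow> (nat \<Rightarrow> nat) \<Rightarrow> 'k::field"
  assumes R: "ring (kA4 :: ((nat \<Rightarrow> nat) \<Rightarrow> 'k) ring)" and two: "(1::'k::field) + 1 = 0"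
    and w: "w \<in> carrier (free_lmodule kA4 I)"
    and N: "comb (free_lmodule kA4 I) w (1, 1, 1, 1) = \<zero>\<^bsub>free_lmodule kA4 I\<^esub>"
  obtains p q r where "p \<in> carrier (free_lmodule kA4 I)" "q \<in> carrier (free_lmodule kA4 I)" "r \<in> carrier (free_lmodule kA4 I)"
    "w = (act (free_lmodule kA4 I) a\<^sub>4 p \<oplus>\<^bsub>free_lmodule kA4 I\<^esub> p)
       \<oplus>\<^bsub>free_lmodule kA4 I\<^esub> (act (free_lmodule kA4 I) b\<^sub>4 q \<oplus>\<^bsub>free_lmodule kA4 I\<^esub> q)
       \<oplus>\<^bsub>free_lmodule kA4 I\<^esub> (act (free_lmodule kA4 I) (a\<^sub>4 \<circ> b\<^sub>4) r \<oplus>\<^bsub>free_lmodule kA4 I\<^esub> r)"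
proof -
  let ?F = "free_lmodule (kA4 :: ((nat \<Rightarrow> nat) \<Rightarrow> 'k) ring) I"
  interpret F: kA4_module ?F using R two by (rule free_kA4_module)
  \<comment> \<open>The families \<open>w\<^sub>v\<close>: supported on the permutations that fix 4.\<close>
  define pt where "pt v i x = (if x \<in> carrier A4 \<and> x 4 = 4 then w i (v \<circ> x) else 0)" for v i x
  note G = A4_gens comp_in_A4
  have wR: "w i \<in> carrier kA4" "i \<notin> I \<Longrightarrow> w i = (\<lambda>x. 0)" "finite {i. w i \<noteq> (\<lambda>x. 0)}" for i
    using w by (auto simp: free_lmodule_def kA4_zero)
  have pt: "pt v \<in> carrier ?F" for v
  proof -
    have "{i. pt v i \<noteq> (\<lambda>x. 0)} \<subseteq> {i. w i \<noteq> (\<lambda>x. 0)}" by (auto simp: pt_def fun_eq_iff)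
    then have "finite {i. pt v i \<noteq> (\<lambda>x. 0)}" using wR(3) by (rule finite_subset)
    moreover have "pt v i = (\<lambda>x. 0)" if "i \<notin> I" for i using wR(2)[OF that] by (auto simp: pt_def)
    moreover have "pt v i \<in> carrier kA4" for i by (auto simp: kA4_carrier pt_def)
    ultimately show ?thesis by (simp add: free_lmodule_def kA4_zero)
  qed
  have inv: "inv' v = v" if "v \<circ> v = id" for v :: "nat \<Rightarrow> nat" using that by (rule inv_unique_comp) (fact that)
  have V2: "a\<^sub>4 \<circ> a\<^sub>4 = id" "b\<^sub>4 \<circ> b\<^sub>4 = id" "(a\<^sub>4 \<circ> b\<^sub>4) \<circ> (a\<^sub>4 \<circ> b\<^sub>4) = id"
    by (auto simp: fun_eq_iff a4_apply b4_apply)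
  have act: "act ?F v u i x = u i (v \<circ> x)" if "v \<in> carrier A4" "v \<circ> v = id" "x \<in> carrier A4" for v u i x
    using that inv[OF that(2)] by (simp add: act_def free_lmodule_def mon_mult del: comp_apply)
  have add: "(u \<oplus>\<^bsub>?F\<^esub> v) i x = u i x + v i x" for u v i x by (simp add: free_lmodule_def kA4_add)
  have norm: "w i x + w i (a\<^sub>4 \<circ> x) + w i (b\<^sub>4 \<circ> x) + w i (a\<^sub>4 \<circ> b\<^sub>4 \<circ> x) = 0" if x: "x \<in> carrier A4" for i x
  proof -
    have "comb ?F w (1, 1, 1, 1) i x = 0" unfolding N by (simp add: free_lmodule_def kA4_zero)
    then show ?thesis using w x G V2
      by (simp add: comb_def add act del: comp_apply)
  qed
  let ?S = "(act ?F a\<^sub>4 (pt a\<^sub>4) \<oplus>\<^bsub>?F\<^esub> pt a\<^sub>4) \<oplus>\<^bsub>?F\<^esub> (act ?F b\<^sub>4 (pt b\<^sub>4) \<oplus>\<^bsub>?F\<^esub> pt b\<^sub>4)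
    \<oplus>\<^bsub>?F\<^esub> (act ?F (a\<^sub>4 \<circ> b\<^sub>4) (pt (a\<^sub>4 \<circ> b\<^sub>4)) \<oplus>\<^bsub>?F\<^esub> pt (a\<^sub>4 \<circ> b\<^sub>4))"
  have "?S \<in> carrier ?F" by (intro F.M.a_closed F.act_closed pt G)
  then have "?S i \<in> carrier kA4" for i by (simp add: free_lmodule_def)
  then have out: "?S i x = w i x" if "x \<notin> carrier A4" for i x
    using wR(1)[of i] that unfolding kA4_carrier by metis
  have "?S i x = w i x" if x: "x \<in> carrier A4" for i x
  proof -
    have vv: "v \<circ> (v \<circ> x) = x" if "v \<circ> v = id" for v using that by (metis comp_assoc id_comp)
    have S: "?S i x = (pt a\<^sub>4 i (a\<^sub>4 \<circ> x) + pt a\<^sub>4 i x) + (pt b\<^sub>4 i (b\<^sub>4 \<circ> x) + pt b\<^sub>4 i x)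
      + (pt (a\<^sub>4 \<circ> b\<^sub>4) i ((a\<^sub>4 \<circ> b\<^sub>4) \<circ> x) + pt (a\<^sub>4 \<circ> b\<^sub>4) i x)"
      using x G V2 by (simp add: add act del: comp_apply)
    have up: "pt v i (v \<circ> x) = (if v (x 4) = 4 then w i x else 0)" if "v \<in> carrier A4" "v \<circ> v = id" for v
      using vv[OF that(2)] comp_in_A4[OF that(1) x] by (simp add: pt_def)
    have ups: "pt a\<^sub>4 i (a\<^sub>4 \<circ> x) = (if x 4 = 3 then w i x else 0)" "pt b\<^sub>4 i (b\<^sub>4 \<circ> x) = (if x 4 = 2 then w i x else 0)"
      "pt (a\<^sub>4 \<circ> b\<^sub>4) i ((a\<^sub>4 \<circ> b\<^sub>4) \<circ> x) = (if x 4 = 1 then w i x else 0)"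
      using G V2 by (simp_all add: up) (auto simp: a4_apply b4_apply)
    have "x 4 \<in> {1, 2, 3, 4}" using A4_image[OF x, of 4] by simp
    moreover have "w i x + (w i (a\<^sub>4 \<circ> x) + w i (b\<^sub>4 \<circ> x) + w i ((a\<^sub>4 \<circ> b\<^sub>4) \<circ> x)) = 0"
      using norm[OF x, of i] by (simp only: add.assoc)
    then have "w i (a\<^sub>4 \<circ> x) + w i (b\<^sub>4 \<circ> x) + w i ((a\<^sub>4 \<circ> b\<^sub>4) \<circ> x) = w i x"
      by (simp only: add_eq_0_iff F.char2')
    ultimately show ?thesis using x unfolding S ups by (auto simp: pt_def add.assoc)
  qed
  then have "?S = w" using out by (intro ext) metis
  then show ?thesis using that pt by metis
qed

text \<open>The superfluous kernel makes the coordinates surjective; the embedding into a free module makes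
  them injective, since a relation would put the eigenvector into the kernel of the cover.\<close>

lemma projective_cover_frame:
  fixes T :: "((nat \<Rightarrow> nat) \<Rightarrow> 'k::field, 'm) module" and P :: "((nat \<Rightarrow> nat) \<Rightarrow> 'k, 'p) module"
  assumes T: "kA4_module T" "A4_module \<chi> T" and cover: "projective_cover kA4 P f T"
    and \<chi>: "\<chi> ^ 3 = 1" and \<omega>: "\<omega> ^ 3 = 1" "\<omega> \<noteq> 1"
  obtains p where "kA4_frame P \<chi> p \<omega>"
proof -
  interpret T: kA4_module T by fact
  note G = A4_gens comp_in_A4
  have "left_module kA4 P" using cover by (simp add: projective_cover_def projective_module_def)
  then have P: "kA4_module P" using T.two by (simp add: kA4_module_def kA4_module_axioms_def)
  then interpret P: kA4_module P .
  have f: "f \<in> lmod_hom kA4 P T" and fsurj: "f ` carrier P = carrier T"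
    using cover by (auto simp: projective_cover_def)
  have superfluous: "H = carrier P" if "submodule H kA4 P" "H <+>\<^bsub>P\<^esub> a_kernel P T f = carrier P" for H
    using cover that by (auto simp: projective_cover_def)
  have fadd: "f (y \<oplus>\<^bsub>P\<^esub> z) = f y \<oplus>\<^bsub>T\<^esub> f z" if "y \<in> carrier P" "z \<in> carrier P" for y z
    using f that by (simp add: lmod_hom_def)
  have fc: "f y \<in> carrier T" if "y \<in> carrier P" for y using fsurj that by blast
  from T(2) obtain t where t: "t \<in> carrier T" "t \<noteq> \<zero>\<^bsub>T\<^esub>" "\<And>x. x \<in> carrier T \<Longrightarrow> \<exists>c. x = scal T c t"
    and a: "\<And>x. x \<in> carrier T \<Longrightarrow> act T a\<^sub>4 x = x" and b: "\<And>x. x \<in> carrier T \<Longrightarrow> act T b\<^sub>4 x = x"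
    and g: "\<And>x. x \<in> carrier T \<Longrightarrow> act T g\<^sub>4 x = scal T \<chi> x" by (rule A4_moduleD) blast
  have ab: "act T (a\<^sub>4 \<circ> b\<^sub>4) x = x" if "x \<in> carrier T" for x
    using T.act_act[of a\<^sub>4 b\<^sub>4 x] a b G that by simp
  obtain q where q: "q \<in> carrier P" "f q = t" using t(1) unfolding fsurj[symmetric] by (auto simp: image_iff)
  define p where "p = P.eigen_proj \<chi> q"
  have p: "p \<in> carrier P" and gp: "act P g\<^sub>4 p = scal P \<chi> p"
    using q P.act_eigen_proj[OF _ \<chi>] by (auto simp: p_def)
  have fp: "f p = t"
    unfolding p_def eigen_proj_hom[OF P T(1) f q(1)] q(2) using t(1) g \<chi> by (intro T.eigen_proj_fixed)
  interpret E: kA4_eigenvector P \<chi> p by unfold_locales (fact p gp)+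
  have "submodule (range (comb P p)) kA4 P" by (rule E.submodule_image) auto
  moreover have "range (comb P p) <+>\<^bsub>P\<^esub> a_kernel P T f = carrier P"
  proof
    show "range (comb P p) <+>\<^bsub>P\<^esub> a_kernel P T f \<subseteq> carrier P"
      using p by (auto simp: set_add_def' a_kernel_def')
    show "carrier P \<subseteq> range (comb P p) <+>\<^bsub>P\<^esub> a_kernel P T f"
    proof
      fix x assume x: "x \<in> carrier P"
      then obtain c where c: "f x = scal T c t" using t(3)[OF fc] by blast
      define z where "z = scal P c p \<oplus>\<^bsub>P\<^esub> x"
      have "f z = \<zero>\<^bsub>T\<^esub>" using x p t(1) by (simp add: z_def fadd lmod_hom_scal[OF f] fp c)
      then have "z \<in> a_kernel P T f" using x p by (simp add: z_def a_kernel_def')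
      moreover have "x = scal P c p \<oplus>\<^bsub>P\<^esub> z" using x p by (simp add: z_def P.add_cancel2)
      moreover have "scal P c p = comb P p (c, 0, 0, 0)" using p by (simp add: comb_def G)
      ultimately show "x \<in> range (comb P p) <+>\<^bsub>P\<^esub> a_kernel P T f" unfolding set_add_def' by blast
    qed
  qed
  ultimately have surj: "range (comb P p) = carrier P" by (rule superfluous)
  have "u = 0" if u: "comb P p u = \<zero>\<^bsub>P\<^esub>" for u
  proof (rule ccontr)
    assume "u \<noteq> 0"
    with u have N: "comb P p (1, 1, 1, 1) = \<zero>\<^bsub>P\<^esub>" by (rule E.\<Phi>_socle)
    from cover obtain I :: "'p set" and \<iota> \<pi> where \<iota>: "\<iota> \<in> lmod_hom kA4 P (free_lmodule kA4 I)"
      and \<pi>: "\<pi> \<in> lmod_hom kA4 (free_lmodule kA4 I) P" and \<pi>\<iota>: "\<And>x. x \<in> carrier P \<Longrightarrow> \<pi> (\<iota> x) = x"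
      by (auto simp: projective_cover_def projective_module_def)
    let ?F = "free_lmodule (kA4 :: ((nat \<Rightarrow> nat) \<Rightarrow> 'k) ring) I"
    have F: "kA4_module ?F" using T.R.ring_axioms P.two by (rule free_kA4_module)
    interpret F: kA4_module ?F by fact
    have w: "\<iota> p \<in> carrier ?F" using \<iota> p by (auto simp: lmod_hom_def)
    have "\<iota> \<zero>\<^bsub>P\<^esub> = \<zero>\<^bsub>?F\<^esub>" using lmod_hom_scal[OF \<iota> p, of 0] p w by simp
    then have "comb ?F (\<iota> p) (1, 1, 1, 1) = \<zero>\<^bsub>?F\<^esub>"
      using comb_hom[OF P \<iota> p, of "(1, 1, 1, 1)"] N by simp
    from free_norm_zero[OF T.R.ring_axioms P.two w this]
    obtain x y z where xyz: "x \<in> carrier ?F" "y \<in> carrier ?F" "z \<in> carrier ?F"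
      and eq: "\<iota> p = (act ?F a\<^sub>4 x \<oplus>\<^bsub>?F\<^esub> x) \<oplus>\<^bsub>?F\<^esub> (act ?F b\<^sub>4 y \<oplus>\<^bsub>?F\<^esub> y) \<oplus>\<^bsub>?F\<^esub> (act ?F (a\<^sub>4 \<circ> b\<^sub>4) z \<oplus>\<^bsub>?F\<^esub> z)" .
    have \<pi>add: "\<pi> (y \<oplus>\<^bsub>?F\<^esub> z) = \<pi> y \<oplus>\<^bsub>P\<^esub> \<pi> z" if "y \<in> carrier ?F" "z \<in> carrier ?F" for y z
      using \<pi> that by (simp add: lmod_hom_def)
    have \<pi>c: "\<pi> y \<in> carrier P" if "y \<in> carrier ?F" for y using \<pi> that by (auto simp: lmod_hom_def)
    have "p = \<pi> (\<iota> p)" using \<pi>\<iota> p by simp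
    also have "\<dots> = (act P a\<^sub>4 (\<pi> x) \<oplus>\<^bsub>P\<^esub> \<pi> x) \<oplus>\<^bsub>P\<^esub> (act P b\<^sub>4 (\<pi> y) \<oplus>\<^bsub>P\<^esub> \<pi> y) \<oplus>\<^bsub>P\<^esub> (act P (a\<^sub>4 \<circ> b\<^sub>4) (\<pi> z) \<oplus>\<^bsub>P\<^esub> \<pi> z)"
      unfolding eq using xyz by (simp add: \<pi>add lmod_hom_act[OF \<pi>] G)
    also have "f \<dots> = \<zero>\<^bsub>T\<^esub>"
      using xyz \<pi>c fc by (simp add: fadd lmod_hom_act[OF f] G a b ab)
    finally show False using fp t by simp
  qed
  then have "kA4_frame P \<chi> p \<omega>" using surj \<chi> \<omega> by unfold_locales auto
  then show ?thesis by (rule that)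
qed

text \<open>The left ideal generated by the idempotent of the eigenvalue \<open>\<chi>\<close> is a direct summand of the
  regular module. As \<open>V\<^sub>4\<close>-module it is \<open>kV\<^sub>4\<close>, a local ring, so an element with nonzero image in the simple module
  generates it.\<close>

lemma projective_cover_exists:
  fixes T :: "((nat \<Rightarrow> nat) \<Rightarrow> 'k::field, 'm) module"
  assumes T: "kA4_module T" "A4_module \<chi> T" and \<chi>: "\<chi> ^ 3 = 1"
  obtains P :: "((nat \<Rightarrow> nat) \<Rightarrow> 'k, (nat \<Rightarrow> nat) \<Rightarrow> 'k) module" and f where "projective_cover kA4 P f T"
proof -
  interpret T: kA4_module T by fact
  note G = A4_gens comp_in_A4
  from T(2) obtain t where t: "t \<in> carrier T" "t \<noteq> \<zero>\<^bsub>T\<^esub>" "\<And>x. x \<in> carrier T \<Longrightarrow> \<exists>c. x = scal T c t"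
    and a: "\<And>x. x \<in> carrier T \<Longrightarrow> act T a\<^sub>4 x = x" and b: "\<And>x. x \<in> carrier T \<Longrightarrow> act T b\<^sub>4 x = x"
    and g: "\<And>x. x \<in> carrier T \<Longrightarrow> act T g\<^sub>4 x = scal T \<chi> x" by (rule A4_moduleD) blast
  define M :: "((nat \<Rightarrow> nat) \<Rightarrow> 'k, (nat \<Rightarrow> nat) \<Rightarrow> 'k) module" where
    "M = \<lparr>carrier = carrier kA4, mult = undefined, one = undefined, zero = \<zero>\<^bsub>kA4\<^esub>, add = (\<oplus>\<^bsub>kA4\<^esub>), smult = (\<otimes>\<^bsub>kA4\<^esub>)\<rparr>"
  have Ms [simp]: "carrier M = carrier kA4" "zero M = \<zero>\<^bsub>kA4\<^esub>" "add M = add kA4" "smult M = mult kA4"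
    by (simp_all add: M_def)
  have "abelian_group M" using T.R.a_ac T.R.l_neg by (intro abelian_groupI) auto
  moreover have "left_module_axioms kA4 M"
    by unfold_locales (auto simp: T.R.l_distr T.R.r_distr T.R.m_assoc)
  ultimately have "left_module kA4 M" by (intro left_module.intro T.R.ring_axioms)
  then have M: "kA4_module M" using T.two by (simp add: kA4_module_def kA4_module_axioms_def)
  interpret M: kA4_module M by fact
  define e where "e = M.eigen_proj \<chi> \<one>\<^bsub>kA4\<^esub>"
  have e: "e \<in> carrier kA4" and ge: "act M g\<^sub>4 e = scal M \<chi> e"
    using M.eigen_proj_closed[of "\<one>\<^bsub>kA4\<^esub>" \<chi>] M.act_eigen_proj[of "\<one>\<^bsub>kA4\<^esub>" \<chi>] \<chi> by (auto simp: e_def)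
  interpret E: kA4_eigenvector M \<chi> e by unfold_locales (use e ge in auto)
  have e_hom: "(\<lambda>r. r \<otimes>\<^bsub>kA4\<^esub> e) \<in> lmod_hom kA4 M M"
    using e by (auto simp: lmod_hom_def T.R.l_distr T.R.m_assoc)
  have "e \<otimes>\<^bsub>kA4\<^esub> e = M.eigen_proj \<chi> (\<one>\<^bsub>kA4\<^esub> \<otimes>\<^bsub>kA4\<^esub> e)"
    using eigen_proj_hom[OF M M e_hom, of "\<one>\<^bsub>kA4\<^esub>" \<chi>] by (simp add: e_def)
  also have "\<dots> = e" using e ge \<chi> by (simp add: M.eigen_proj_fixed)
  finally have ee: "e \<otimes>\<^bsub>kA4\<^esub> e = e" .
  define Q where "Q = range (comb M e)"
  have Qe: "x \<otimes>\<^bsub>kA4\<^esub> e = x" if "x \<in> Q" for x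
    using that comb_hom[OF M e_hom] e ee by (auto simp: Q_def)
  have Q: "submodule Q kA4 M" unfolding Q_def by (rule E.submodule_image) auto
  have eQ: "e \<in> Q" using M.comb_1000[of e] e unfolding Q_def by (metis Ms(1) rangeI)
  have QR: "x \<in> carrier kA4" if "x \<in> Q" for x using M.submoduleD(1)[OF Q] that by auto
  define P where "P = M\<lparr>carrier := Q\<rparr>"
  have P: "kA4_module P" unfolding P_def using Q by (rule M.submodule_is_module)
  have Ps [simp]: "carrier P = Q" "zero P = \<zero>\<^bsub>kA4\<^esub>" "add P = add kA4" "smult P = mult kA4"
    by (simp_all add: P_def)
  have combP: "comb P = comb M" by (simp add: comb_def scal_def act_def fun_eq_iff)
  interpret P: kA4_module P by fact
  have "projective_module kA4 P"
    unfolding projective_module_def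
  proof (intro conjI exI bexI ballI)
    let ?I = "{e}" and ?\<iota> = "\<lambda>x i. if i = e then x else \<zero>\<^bsub>kA4\<^esub>" and ?\<pi> = "\<lambda>u. u e \<otimes>\<^bsub>kA4\<^esub> e"
    show "?\<iota> \<in> lmod_hom kA4 P (free_lmodule kA4 ?I)"
    proof -
      have "finite {i. (if i = e then x else \<zero>\<^bsub>kA4\<^esub>) \<noteq> \<zero>\<^bsub>kA4\<^esub>}" for x
        by (rule finite_subset[of _ "{e}"]) auto
      then show ?thesis using QR by (auto simp: lmod_hom_def free_lmodule_def fun_eq_iff[where 'a = "(nat \<Rightarrow> nat) \<Rightarrow> 'k"])
    qed
    show "?\<pi> \<in> lmod_hom kA4 (free_lmodule kA4 ?I) P"
      using e submodule.smult_closed[OF Q _ eQ]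
      by (auto simp: lmod_hom_def free_lmodule_def T.R.l_distr T.R.m_assoc)
    show "?\<pi> (?\<iota> x) = x" if "x \<in> carrier P" for x using that Qe by simp
    show "left_module kA4 P" by (rule P.left_module_axioms)
  qed
  define f where "f r = r \<odot>\<^bsub>T\<^esub> t" for r
  have f: "f \<in> lmod_hom kA4 M T"
    using t(1) by (auto simp: lmod_hom_def f_def T.smult_closed T.smult_l_distr T.smult_assoc)
  then have fP: "f \<in> lmod_hom kA4 P T" using QR by (auto simp: lmod_hom_def)
  have "f e = T.eigen_proj \<chi> t"
    using eigen_proj_hom[OF M T(1) f, of "\<one>\<^bsub>kA4\<^esub>" \<chi>] T.smult_one[OF t(1)] by (simp add: e_def f_def)
  then have fe: "f e = t" using t(1) g \<chi> by (simp add: T.eigen_proj_fixed)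
  have fcomb: "f (comb M e (\<alpha>, \<beta>, \<gamma>, \<delta>)) = scal T (\<alpha> + \<beta> + \<gamma> + \<delta>) t" for \<alpha> \<beta> \<gamma> \<delta>
    using comb_hom[OF M f, of e] e t(1) a b by (simp add: fe T.comb_fixed)
  have fsurj: "f ` carrier P = carrier T"
  proof
    show "f ` carrier P \<subseteq> carrier T" using fP by (auto simp: lmod_hom_def)
    show "carrier T \<subseteq> f ` carrier P"
    proof
      fix x assume "x \<in> carrier T"
      then obtain c where "x = scal T c t" using t(3) by blast
      then have "x = f (comb M e (c, 0, 0, 0))" by (simp add: fcomb)
      then show "x \<in> f ` carrier P" by (auto simp: Q_def)
    qed
  qed
  have "H = carrier P" if H: "submodule H kA4 P" and sum: "H <+>\<^bsub>P\<^esub> a_kernel P T f = carrier P" for H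
  proof -
    note D = P.submoduleD[OF H]
    have "e \<in> H <+>\<^bsub>P\<^esub> a_kernel P T f" using sum eQ by simp
    then obtain h z where hz: "h \<in> H" "z \<in> Q" "f z = \<zero>\<^bsub>T\<^esub>" "e = h \<oplus>\<^bsub>kA4\<^esub> z"
      by (auto simp: set_add_def' a_kernel_def')
    have hQ: "h \<in> Q" using D(1) hz(1) by auto
    have "f e = f h \<oplus>\<^bsub>T\<^esub> f z" using fP hQ hz(2,4) by (auto simp: lmod_hom_def)
    moreover have "f h \<in> carrier T" using fsurj hQ by auto
    ultimately have fh: "f h = t" using hz(3) fe by simp
    obtain \<alpha> \<beta> \<gamma> \<delta> where h: "h = comb M e (\<alpha>, \<beta>, \<gamma>, \<delta>)" using hQ unfolding Q_def by (metis imageE prod_cases4)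
    have "scal T (\<alpha> + \<beta> + \<gamma> + \<delta>) t = scal T 1 t" using fh t(1) unfolding h fcomb by simp
    then have "\<alpha> + \<beta> + \<gamma> + \<delta> = 1" using T.scal_inject[OF t(1,2)] by blast
    then have "comb M h (\<alpha>, \<beta>, \<gamma>, \<delta>) = e" using M.comb_comb[of e] e by (simp add: h)
    moreover have combH: "comb P x u \<in> H" if "x \<in> H" for x u
      using H that by (rule P.submodule_comb)
    ultimately have "e \<in> H" using hz(1) combP by metis
    then have "Q \<subseteq> H" using combH combP by (auto simp: Q_def)
    then show ?thesis using D(1) by auto
  qed
  then have "projective_cover kA4 P f T"
    using \<open>projective_module kA4 P\<close> T.left_module_axioms fP fsurj by (auto simp: projective_cover_def)
  then show ?thesis by (rule that)
qed

section \<open>The Cartan matrix\<close>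

lemma cartan_invariant_eq:
  fixes S :: "((nat \<Rightarrow> nat) \<Rightarrow> 'k::field, 's) module" and T :: "((nat \<Rightarrow> nat) \<Rightarrow> 'k, 't) module"
  assumes S: "kA4_module S" "A4_module \<psi> S" "\<psi> ^ 3 = 1" and T: "kA4_module T" "A4_module \<chi> T" "\<chi> ^ 3 = 1"
    and \<omega>: "\<omega> ^ 3 = 1" "(\<omega>::'k) \<noteq> 1"
  shows "cartan_invariant kA4 S T = (if \<chi> = \<psi> then 2 else 1)"
proof -
  have 1: "composition_multiplicity kA4 S P = (if \<chi> = \<psi> then 2 else 1)" if "projective_cover kA4 P f T"
    for P :: "((nat \<Rightarrow> nat) \<Rightarrow> 'k, (nat \<Rightarrow> nat) \<Rightarrow> 'k) module" and f
  proof -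
    from projective_cover_frame[OF T(1,2) that T(3) \<omega>] obtain p where "kA4_frame P \<chi> p \<omega>" .
    then show ?thesis using S by (rule kA4_frame.composition_multiplicity_eq)
  qed
  obtain P :: "((nat \<Rightarrow> nat) \<Rightarrow> 'k, (nat \<Rightarrow> nat) \<Rightarrow> 'k) module" and f where "projective_cover kA4 P f T"
    using projective_cover_exists[OF T] .
  then show ?thesis unfolding cartan_invariant_def using 1 by (intro the_equality) metis+
qed

theorem mainTheorem4:
  fixes \<omega> :: "'k :: alg_closed_field"
    and T\<^sub>1 T\<^sub>2 T\<^sub>3 :: "((nat \<Rightarrow> nat) \<Rightarrow> 'k, 'm) module"
  assumes char_2: "CHAR('k) = 2"
    and omega: "primitive_root_of_unity 3 \<omega>"
    and "A4_module 1 T\<^sub>1" and "A4_module \<omega> T\<^sub>2" and "A4_module (\<omega> ^ 2) T\<^sub>3"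
  shows "(\<forall>T\<in>{T\<^sub>1, T\<^sub>2, T\<^sub>3}. simple_module (group_algebra A4) T)
    \<and> \<not> lmod_isomorphic (group_algebra A4) T\<^sub>1 T\<^sub>2
    \<and> \<not> lmod_isomorphic (group_algebra A4) T\<^sub>1 T\<^sub>3
    \<and> \<not> lmod_isomorphic (group_algebra A4) T\<^sub>2 T\<^sub>3
    \<and> (\<forall>S :: ((nat \<Rightarrow> nat) \<Rightarrow> 'k, 'n) module. simple_module (group_algebra A4) S \<longrightarrow>
         (\<exists>T\<in>{T\<^sub>1, T\<^sub>2, T\<^sub>3}. lmod_isomorphic (group_algebra A4) S T))
    \<and> cartan_matrix (group_algebra A4) [T\<^sub>1, T\<^sub>2, T\<^sub>3] =
        mat_of_rows_list 3 [[2, 1, 1], [1, 2, 1], [1, 1, 2]]"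
proof -
  have "of_nat CHAR('k) = (0::'k)" by (rule of_nat_CHAR)
  then have two: "(1::'k) + 1 = 0" by (simp add: char_2)
  have \<omega>: "\<omega> ^ 3 = 1" "\<omega> \<noteq> 1" and \<omega>2: "\<omega> ^ 2 \<noteq> 1"
    using omega by (auto simp: primitive_root_of_unity_def dest: spec[of _ 1] spec[of _ 2])
  have \<omega>2': "(\<omega> ^ 2) ^ 3 = 1" using \<omega> by (metis power_mult mult.commute power_one)
  have "\<omega> ^ 2 \<noteq> \<omega>" using \<omega> by (auto simp: power2_eq_square)
  note distinct = \<omega>(2) \<omega>2 this
  have mod: "kA4_module X" if "left_module kA4 X" for X :: "((nat \<Rightarrow> nat) \<Rightarrow> 'k, 'y) module"
    using that two by (simp add: kA4_module_def kA4_module_axioms_def)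
  have T: "kA4_module T\<^sub>1" "kA4_module T\<^sub>2" "kA4_module T\<^sub>3"
    using assms(3-5) mod by (auto simp: A4_module_def)
  have "\<exists>T\<in>{T\<^sub>1, T\<^sub>2, T\<^sub>3}. lmod_isomorphic kA4 S T" if S: "simple_module kA4 S" 
    for S :: "((nat \<Rightarrow> nat) \<Rightarrow> 'k, 'n) module"
  proof -
    have "left_module kA4 S" using S by (simp add: simple_module_def)
    then have "kA4_module S" using two by (simp add: kA4_module_def kA4_module_axioms_def)
    then show ?thesis
      using simple_imp_A4_module[OF _ S \<omega>] A4_module_isomorphic[of S] T assms(3-5) by blast
  qed
  moreover have "cartan_matrix kA4 [T\<^sub>1, T\<^sub>2, T\<^sub>3] = mat_of_rows_list 3 [[2, 1, 1], [1, 2, 1], [1, 1, 2]]"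
  proof (rule eq_matI)
    note C = cartan_invariant_eq[OF _ _ _ _ _ _ \<omega>]
    fix i j assume "i < dim_row (mat_of_rows_list 3 [[2, 1, 1], [1, 2, 1], [1, 1, 2::nat]])"
      "j < dim_col (mat_of_rows_list 3 [[2, 1, 1], [1, 2, 1], [1, 1, 2::nat]])"
    then have "i < 3" "j < 3" by (auto simp: mat_of_rows_list_def)
    then have ij: "i \<in> {0, 1, 2}" "j \<in> {0, 1, 2}" by auto
    show "cartan_matrix kA4 [T\<^sub>1, T\<^sub>2, T\<^sub>3] $$ (i, j) = mat_of_rows_list 3 [[2, 1, 1], [1, 2, 1], [1, 1, 2]] $$ (i, j)"
      using ij distinct distinct[symmetric] \<omega>(1) \<omega>2'
        C[OF T(1) assms(3) _ T(1) assms(3)] C[OF T(1) assms(3) _ T(2) assms(4)] C[OF T(1) assms(3) _ T(3) assms(5)]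
        C[OF T(2) assms(4) _ T(1) assms(3)] C[OF T(2) assms(4) _ T(2) assms(4)] C[OF T(2) assms(4) _ T(3) assms(5)]
        C[OF T(3) assms(5) _ T(1) assms(3)] C[OF T(3) assms(5) _ T(2) assms(4)] C[OF T(3) assms(5) _ T(3) assms(5)]
      by (auto simp: cartan_matrix_def mat_of_rows_list_def)
  qed (auto simp: cartan_matrix_def mat_of_rows_list_def)
  ultimately show ?thesis
    using A4_module_simple[OF T(1) assms(3)] A4_module_simple[OF T(2) assms(4)] A4_module_simple[OF T(3) assms(5)]
      A4_module_isomorphic_imp_eq[OF T(1,2) assms(3,4)] A4_module_isomorphic_imp_eq[OF T(1,3) assms(3,5)]
      A4_module_isomorphic_imp_eq[OF T(2,3) assms(4,5)] distinct by auto
qed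

end
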